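(* Let $(X,d)$ be a compact metric space, $f_{0,\infty}=\{f_n\}_{n=0}^\infty$ a sequence of continuous self-maps of $X$, and $A\in\mathcal{S}$. Then $h_A(f_{0,\infty})=0$ if and only if $h_A(\hat{f}_{0,\infty})=0$. Consequently, $(X,f_{0,\infty})$ is null if and only if $(\mathcal{M}(X),\hat f_{0,\infty})$ is null.
   Context: $f_0^n=f_{n-1}\circ\cdots\circ f_0$, $f_0^0=\mathrm{id}$. $\mathcal S$ is the set of strictly increasing sequences $A=\{a_i\}_{i\ge1}$ of nonnegative integers. For a compact metric space $Z$ and continuous self-maps $g_{0,\infty}$ of $Z$, $h_A(g_{0,\infty})=\sup_{\mathscr A}\limsup_{n\to\infty}\frac1n\log\mathcal N(\bigvee_{i=1}^n (g_0^{a_i})^{-1}\mathscr A)$ over finite open covers $\mathscr A$ of $Z$ ($\bigvee$ = common refinement, $\mathcal N$ = minimal cardinality of a subcover). $\mathcal M(X)$ is the space of Borel probability measures on $X$ with the weak$^*$ topology (a compact metric space, e.g. with the Prohorov metric $\mathcal P_d(\mu,\nu)=\inf\{\epsilon>0:\mu(B)\le\nu(B^\epsilon)+\epsilon\ \forall B \text{ Borel}\}$, $B^\epsilon=\{x:d(x,B)<\epsilon\}$), and $\hat f_{0,\infty}=\{\hat f_n\}$ with $\hat f_n(\mu)(B)=\mu(f_n^{-1}(B))$; each $\hat f_n$ is continuous. A system is null if $h_A=0$ for every $A\in\mathcal S$. *)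

theory Defs
  imports "HOL-Analysis.Analysis" "HOL-Probability.Probability"
begin

primrec comp_seq :: "(nat \<Rightarrow> 'a \<Rightarrow> 'a) \<Rightarrow> nat \<Rightarrow> 'a \<Rightarrow> 'a" where
  "comp_seq g 0 = id"
| "comp_seq g (Suc n) = g n \<circ> comp_seq g n"

definition open_covers :: "'a topology \<Rightarrow> 'a set set set" where
  "open_covers T = {\<A>. finite \<A> \<and> (\<forall>U\<in>\<A>. openin T U) \<and> \<Union>\<A> = topspace T}"

text \<open>The join of the pulled-back covers (g_0^{a_i})^{-1} A for i = 1..n; the sequence
  a_1 < a_2 < ... is represented as a 0 < a 1 < ..., i.e. indices 0..<n.\<close>
definition join_cover ::
  "'a topology \<Rightarrow> (nat \<Rightarrow> 'a \<Rightarrow> 'a) \<Rightarrow> (nat \<Rightarrow> nat) \<Rightarrow> 'a set set \<Rightarrow> nat \<Rightarrow> 'a set set" where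
  "join_cover T g a \<A> n =
     {topspace T \<inter> (\<Inter>i\<in>{..<n}. comp_seq g (a i) -` U i) | U. \<forall>i<n. U i \<in> \<A>}"

definition min_subcover :: "'a topology \<Rightarrow> 'a set set \<Rightarrow> nat" where
  "min_subcover T \<U> = Inf {card \<V> | \<V>. \<V> \<subseteq> \<U> \<and> finite \<V> \<and> topspace T \<subseteq> \<Union>\<V>}"

definition seq_entropy :: "'a topology \<Rightarrow> (nat \<Rightarrow> 'a \<Rightarrow> 'a) \<Rightarrow> (nat \<Rightarrow> nat) \<Rightarrow> ereal" where
  "seq_entropy T g a =
     (SUP \<A> \<in> open_covers T.
        limsup (\<lambda>n. ereal (ln (real (min_subcover T (join_cover T g a \<A> n))) / real n)))"

definition null_system :: "'a topology \<Rightarrow> (nat \<Rightarrow> 'a \<Rightarrow> 'a) \<Rightarrow> bool" where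
  "null_system T g \<longleftrightarrow> (\<forall>a. strict_mono a \<longrightarrow> seq_entropy T g a = 0)"

definition prob_measures :: "'a::topological_space set \<Rightarrow> 'a measure set" where
  "prob_measures X = {\<mu>. prob_space \<mu> \<and> sets \<mu> = sets (restrict_space borel X)}"

definition weak_star_topology :: "'a::topological_space set \<Rightarrow> 'a measure topology" where
  "weak_star_topology X = topology_generated_by
     {{\<mu> \<in> prob_measures X. (\<integral>x. \<phi> x \<partial>\<mu>) \<in> U} | \<phi> U.
        continuous_on X (\<phi> :: 'a \<Rightarrow> real) \<and> open U}"

definition push_seq :: "'a::topological_space set \<Rightarrow> (nat \<Rightarrow> 'a \<Rightarrow> 'a) \<Rightarrow> nat \<Rightarrow> 'a measure \<Rightarrow> 'a measure" where
  "push_seq X f n \<mu> = distr \<mu> (restrict_space borel X) (f n)"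

end

theory Submission
  imports Defs
begin

text \<open>
  Dirac measures embed \<open>X\<close> equivariantly into its measures, so zero entropy passes from measures
  to points. Conversely, a cover of the compact space of measures has a Lebesgue number
  \<open>\<epsilon>\<close> with respect to finitely many test functions \<open>F\<close>. Given \<open>n\<close>, cover \<open>X\<close> by \<open>m\<close> sets
  on each of which \<open>\<phi> \<circ> f\<^sub>0\<^bsup>a i\<^esup>\<close> is nearly constant for all \<open>i < n\<close> and \<open>\<phi> \<in> F\<close>;
  \<open>m\<close> grows subexponentially. By Maurey's empirical method in Euclidean space every measure is
  approximated by an average of \<open>K\<close> of \<open>m\<close> fixed points at all but \<open>\<eta> n\<close> of the times
  \<open>i < n\<close>, where \<open>K\<close> depends on \<open>\<eta>\<close> and \<open>\<epsilon>\<close> but not on \<open>n\<close>. Hence \<open>m\<^sup>K\<close> times the size of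
  a Hamming ball of radius \<open>\<eta> n\<close> bounds the size of a subcover, and its exponential growth rate
  tends to \<open>0\<close> with \<open>\<eta>\<close>.
\<close>

subsection \<open>Covers and sequence entropy\<close>

text \<open>Only the values of \<open>U\<close> below \<open>n\<close> enter the intersection, so
  \<open>U\<close> may be taken extensional. This makes the join of a finite cover visibly
  finite.\<close>

lemma join_cover_eq_image:
  "join_cover T g a \<A> n =
     (\<lambda>U. topspace T \<inter> (\<Inter>i\<in>{..<n}. comp_seq g (a i) -` U i)) ` ({..<n} \<rightarrow>\<^sub>E \<A>)"
proof (intro equalityI subsetI)
  fix V assume "V \<in> join_cover T g a \<A> n"
  then obtain U where "V = topspace T \<inter> (\<Inter>i\<in>{..<n}. comp_seq g (a i) -` U i)" "\<forall>i<n. U i \<in> \<A>"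
    by (auto simp: join_cover_def)
  then show "V \<in> (\<lambda>U. topspace T \<inter> (\<Inter>i\<in>{..<n}. comp_seq g (a i) -` U i)) ` ({..<n} \<rightarrow>\<^sub>E \<A>)"
    by (intro image_eqI[where x="restrict U {..<n}"]) auto
qed (auto simp: join_cover_def PiE_iff)

lemma finite_join_cover: "finite \<A> \<Longrightarrow> finite (join_cover T g a \<A> n)"
  unfolding join_cover_eq_image by (intro finite_imageI finite_PiE) auto

lemma comp_seq_in:
  assumes "\<And>n x. x \<in> S \<Longrightarrow> g n x \<in> S" "x \<in> S"
  shows "comp_seq g n x \<in> S"
  using assms by (induction n) auto

lemma join_cover_covers:
  assumes "\<A> \<in> open_covers T" and g: "\<And>n x. x \<in> topspace T \<Longrightarrow> g n x \<in> topspace T"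
  shows "topspace T \<subseteq> \<Union>(join_cover T g a \<A> n)"
proof
  fix x assume x: "x \<in> topspace T"
  have "\<exists>U\<in>\<A>. comp_seq g (a i) x \<in> U" for i
    using comp_seq_in[of "topspace T" g x "a i"] g x assms(1) by (auto simp: open_covers_def)
  then obtain U where "\<And>i. U i \<in> \<A> \<and> comp_seq g (a i) x \<in> U i"
    by metis
  with x show "x \<in> \<Union>(join_cover T g a \<A> n)"
    unfolding join_cover_def by blast
qed

lemma min_subcover_le:
  "\<V> \<subseteq> \<U> \<Longrightarrow> finite \<V> \<Longrightarrow> topspace T \<subseteq> \<Union>\<V> \<Longrightarrow> min_subcover T \<U> \<le> card \<V>"
  unfolding min_subcover_def by (intro cInf_lower) auto

lemma min_subcover_attained:
  assumes "finite \<U>" "topspace T \<subseteq> \<Union>\<U>"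
  obtains \<V> where "\<V> \<subseteq> \<U>" "finite \<V>" "topspace T \<subseteq> \<Union>\<V>" "card \<V> = min_subcover T \<U>"
proof -
  have "min_subcover T \<U> \<in> {card \<V> | \<V>. \<V> \<subseteq> \<U> \<and> finite \<V> \<and> topspace T \<subseteq> \<Union>\<V>}"
    unfolding min_subcover_def using assms by (intro Inf_nat_def1) auto
  then show ?thesis using that by auto
qed

text \<open>Here \<open>e\<close> semiconjugates \<open>g\<close> to \<open>h\<close>, and
  \<open>w V\<close> is a member of \<open>\<U>\<close> containing the preimage of \<open>V\<close>
  under \<open>e\<close>. Replacing every factor \<open>V\<close> by \<open>w V\<close> turns an
  optimal subcover of the join over \<open>T'\<close> into a subcover of the join over
  \<open>T\<close> that is no larger. It is applied to the Dirac embedding.\<close>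

lemma min_subcover_join_mono:
  assumes "\<V> \<in> open_covers T'"
    and h: "\<And>n y. y \<in> topspace T' \<Longrightarrow> h n y \<in> topspace T'"
    and g: "\<And>n x. x \<in> topspace T \<Longrightarrow> g n x \<in> topspace T"
    and e: "\<And>x. x \<in> topspace T \<Longrightarrow> e x \<in> topspace T'"
    and eq: "\<And>n x. x \<in> topspace T \<Longrightarrow> e (g n x) = h n (e x)"
    and w: "\<And>V. V \<in> \<V> \<Longrightarrow> w V \<in> \<U>"
      "\<And>V x. V \<in> \<V> \<Longrightarrow> x \<in> topspace T \<Longrightarrow> e x \<in> V \<Longrightarrow> x \<in> w V"
  shows "min_subcover T (join_cover T g a \<U> n) \<le> min_subcover T' (join_cover T' h a \<V> n)"
proof -
  have fin: "finite (join_cover T' h a \<V> n)"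
    using assms(1) by (auto simp: open_covers_def intro: finite_join_cover)
  obtain \<W> where \<W>: "\<W> \<subseteq> join_cover T' h a \<V> n" "finite \<W>" "topspace T' \<subseteq> \<Union>\<W>"
      "card \<W> = min_subcover T' (join_cover T' h a \<V> n)"
    using min_subcover_attained[OF fin join_cover_covers[OF assms(1) h]] by blast
  \<comment> \<open>A set in the join may arise from several choice functions; one is fixed for each
    \<open>W\<close>.\<close>
  have "\<forall>W\<in>\<W>. \<exists>U. W = topspace T' \<inter> (\<Inter>i\<in>{..<n}. comp_seq h (a i) -` U i) \<and> (\<forall>i<n. U i \<in> \<V>)"
    using \<W>(1) unfolding join_cover_def by blast
  then obtain U where
    U: "\<And>W. W \<in> \<W> \<Longrightarrow> W = topspace T' \<inter> (\<Inter>i\<in>{..<n}. comp_seq h (a i) -` U W i)"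
       "\<And>W i. W \<in> \<W> \<Longrightarrow> i < n \<Longrightarrow> U W i \<in> \<V>"
    by metis
  define P where "P W = topspace T \<inter> (\<Inter>i\<in>{..<n}. comp_seq g (a i) -` w (U W i))" for W
  have comm: "e (comp_seq g k x) = comp_seq h k (e x)" if "x \<in> topspace T" for x k
    using that by (induction k) (auto simp: eq comp_seq_in[of "topspace T" g, OF g])
  have "topspace T \<subseteq> \<Union>(P ` \<W>)"
  proof
    fix x assume x: "x \<in> topspace T"
    then obtain W where W: "W \<in> \<W>" "e x \<in> W" using \<W>(3) e by blast
    have "comp_seq g (a i) x \<in> w (U W i)" if "i < n" for i
      using U(1)[OF W(1)] W that comp_seq_in[of "topspace T" g, OF g x] x
      by (intro w(2) U(2)) (auto simp: comm)
    then show "x \<in> \<Union>(P ` \<W>)" using x W by (auto simp: P_def)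
  qed
  moreover have "P ` \<W> \<subseteq> join_cover T g a \<U> n"
  proof
    fix Y assume "Y \<in> P ` \<W>"
    then obtain W where "W \<in> \<W>" "Y = P W" by auto
    then show "Y \<in> join_cover T g a \<U> n"
      unfolding join_cover_def P_def using U(2) w(1)
      by (auto intro!: exI[of _ "\<lambda>i. w (U W i)"])
  qed
  ultimately have "min_subcover T (join_cover T g a \<U> n) \<le> card (P ` \<W>)"
    using \<W>(2) by (intro min_subcover_le) auto
  also have "\<dots> \<le> card \<W>" using \<W>(2) by (rule card_image_le)
  finally show ?thesis using \<W>(4) by simp
qed

text \<open>The case \<open>n = 0\<close> rests on the convention \<open>ln 0 = 0\<close>; this
  value occurs as a subcover count when the space is empty.\<close>

lemma ln_real_nat_nonneg: "0 \<le> ln (real n)"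
  by (cases n) auto

lemma ln_real_nat_mono: "m \<le> n \<Longrightarrow> ln (real m) \<le> ln (real n)"
  by (cases "m = 0") (auto simp: ln_real_nat_nonneg)

text \<open>All the quotients are nonnegative, so the supremum vanishes exactly when every limsup is
  at most 0. The later estimates can then be carried out in the reals.\<close>

lemma seq_entropy_eq_0_iff:
  "seq_entropy T g a = 0 \<longleftrightarrow>
    (\<forall>\<A>\<in>open_covers T. \<forall>\<gamma>>0. \<forall>\<^sub>F n in sequentially.
       ln (real (min_subcover T (join_cover T g a \<A> n))) / real n < \<gamma>)"
proof -
  define L where "L \<A> = limsup (\<lambda>n. ereal (ln (real (min_subcover T (join_cover T g a \<A> n))) / real n))"
    for \<A>
  have nonneg: "0 \<le> L \<A>" for \<A>
    unfolding L_def by (intro le_Limsup) (auto intro!: always_eventually divide_nonneg_nonneg ln_real_nat_nonneg)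
  \<comment> \<open>The trivial cover keeps the supremum from ranging over an empty family, whose
    value would be minus infinity.\<close>
  have "{topspace T} \<in> open_covers T" by (auto simp: open_covers_def)
  then have "0 \<le> seq_entropy T g a"
    unfolding seq_entropy_def using nonneg[of "{topspace T}"] by (fold L_def) (rule SUP_upper2)
  then have "seq_entropy T g a = 0 \<longleftrightarrow> seq_entropy T g a \<le> 0" by auto
  also have "\<dots> \<longleftrightarrow> (\<forall>\<A>\<in>open_covers T. L \<A> \<le> 0)"
    unfolding seq_entropy_def by (fold L_def) (rule SUP_le_iff)
  finally have "seq_entropy T g a = 0 \<longleftrightarrow> (\<forall>\<A>\<in>open_covers T. L \<A> \<le> 0)" .
  moreover have "L \<A> \<le> 0 \<longleftrightarrow> (\<forall>\<gamma>>0. \<forall>\<^sub>F n in sequentially.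
       ln (real (min_subcover T (join_cover T g a \<A> n))) / real n < \<gamma>)" for \<A>
  proof
    assume "L \<A> \<le> 0"
    show "\<forall>\<gamma>>0. \<forall>\<^sub>F n in sequentially. ln (real (min_subcover T (join_cover T g a \<A> n))) / real n < \<gamma>"
    proof (intro allI impI)
      fix \<gamma> :: real assume "\<gamma> > 0"
      then have "L \<A> < ereal \<gamma>" using \<open>L \<A> \<le> 0\<close> by (simp add: order_le_less_trans)
      from Limsup_lessD[OF this[unfolded L_def]]
      show "\<forall>\<^sub>F n in sequentially. ln (real (min_subcover T (join_cover T g a \<A> n))) / real n < \<gamma>"
        by simp
    qed
  next
    assume *: "\<forall>\<gamma>>0. \<forall>\<^sub>F n in sequentially. ln (real (min_subcover T (join_cover T g a \<A> n))) / real n < \<gamma>"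
    have "L \<A> \<le> 0 + ereal \<gamma>" if "\<gamma> > 0" for \<gamma>
      unfolding L_def using *[rule_format, OF that]
      by (intro Limsup_bounded) (auto elim!: eventually_mono)
    then show "L \<A> \<le> 0" using ereal_le_epsilon2 by blast
  qed
  ultimately show ?thesis by simp
qed

lemma seq_entropy_empty: "topspace T = {} \<Longrightarrow> seq_entropy T g a = 0"
  unfolding seq_entropy_eq_0_iff using min_subcover_le[of "{}" _ T] by (auto intro!: always_eventually)

subsection \<open>Probability measures and the weak* topology\<close>

lemma prob_measuresD:
  assumes "\<mu> \<in> prob_measures X"
  shows "prob_space \<mu>" "sets \<mu> = sets (restrict_space borel X)" "space \<mu> = X"
  using assms sets_eq_imp_space_eq[of \<mu> "restrict_space borel X"]
  by (auto simp: prob_measures_def space_restrict_space)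

lemma openin_weak_star_integral:
  "continuous_on X \<phi> \<Longrightarrow> open U \<Longrightarrow>
     openin (weak_star_topology X) {\<mu> \<in> prob_measures X. (\<integral>x. \<phi> x \<partial>\<mu>) \<in> U}"
  for \<phi> :: "'a::topological_space \<Rightarrow> real"
  unfolding weak_star_topology_def by (intro topology_generated_by_Basis) auto

lemma topspace_weak_star [simp]: "topspace (weak_star_topology X) = prob_measures X"
proof
  show "topspace (weak_star_topology X) \<subseteq> prob_measures X"
    unfolding weak_star_topology_def topology_generated_by_topspace by blast
  \<comment> \<open>The test function 0 with target \<open>UNIV\<close> makes the whole set of
    measures a generator of the topology.\<close>
  show "prob_measures X \<subseteq> topspace (weak_star_topology X)"
    using openin_subset[OF openin_weak_star_integral[of X "\<lambda>_. 0" UNIV]] by simp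
qed

lemma borel_measurable_prob_measures:
  assumes "\<mu> \<in> prob_measures X" "continuous_on X \<phi>"
  shows "\<phi> \<in> borel_measurable \<mu>"
  using borel_measurable_continuous_on_restrict[OF assms(2)] prob_measuresD(2)[OF assms(1)]
  by (simp cong: measurable_cong_sets)

lemma bounded_on_compact:
  fixes \<phi> :: "'a::topological_space \<Rightarrow> real"
  assumes "compact X" "continuous_on X \<phi>"
  obtains B where "B > 0" "\<And>x. x \<in> X \<Longrightarrow> \<bar>\<phi> x\<bar> \<le> B"
  using compact_imp_bounded[OF compact_continuous_image[OF assms(2,1)]]
  unfolding bounded_pos by auto

lemma integrable_prob_measures:
  fixes \<phi> :: "'a::topological_space \<Rightarrow> real"
  assumes "compact X" "\<mu> \<in> prob_measures X" "continuous_on X \<phi>"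
  shows "integrable \<mu> \<phi>"
proof -
  interpret prob_space \<mu> using prob_measuresD assms by auto
  obtain B where "\<And>x. x \<in> X \<Longrightarrow> \<bar>\<phi> x\<bar> \<le> B" using bounded_on_compact assms by metis
  then show ?thesis
    using prob_measuresD(3)[OF assms(2)] borel_measurable_prob_measures[OF assms(2,3)]
    by (intro integrable_const_bound[of _ B]) auto
qed

lemma measurable_self_map:
  assumes "\<mu> \<in> prob_measures X" "continuous_on X g" "g ` X \<subseteq> X"
  shows "g \<in> measurable \<mu> (restrict_space borel X)"
  using borel_measurable_prob_measures[OF assms(1,2)] assms(3) prob_measuresD(3)[OF assms(1)]
  by (intro measurable_restrict_space2) auto

lemma comp_seq_continuous_self_map:
  assumes "\<And>n. continuous_on X (f n)" "\<And>n. f n ` X \<subseteq> X"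
  shows "continuous_on X (comp_seq f n)" "comp_seq f n ` X \<subseteq> X"
proof (induction n)
  case (Suc n)
  { case 1 show ?case using continuous_on_compose[OF Suc(1) continuous_on_subset[OF assms(1) Suc(2)]] by (simp add: o_def) }
  { case 2 show ?case using Suc(2) assms(2)[of n] by auto }
qed auto

lemma push_seq_in_prob_measures:
  assumes "\<mu> \<in> prob_measures X" "continuous_on X (f n)" "f n ` X \<subseteq> X"
  shows "push_seq X f n \<mu> \<in> prob_measures X"
  using prob_space.prob_space_distr[OF prob_measuresD(1)[OF assms(1)] measurable_self_map[OF assms]]
  by (simp add: prob_measures_def push_seq_def)

text \<open>Push-forward is functorial. Hence all iterates of \<open>\<mu>\<close> can be studied by
  integrating different functions against the one measure \<open>\<mu>\<close>.\<close>

lemma comp_seq_push_seq: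
  assumes f: "\<And>n. continuous_on X (f n)" "\<And>n. f n ` X \<subseteq> X" and \<mu>: "\<mu> \<in> prob_measures X"
  shows "comp_seq (push_seq X f) n \<mu> = distr \<mu> (restrict_space borel X) (comp_seq f n)"
proof (induction n)
  case 0
  show ?case using prob_measuresD(2)[OF \<mu>] by (simp add: distr_id2)
next
  case (Suc n)
  have "comp_seq f n \<in> measurable \<mu> (restrict_space borel X)"
    by (intro measurable_self_map comp_seq_continuous_self_map f \<mu>)
  moreover have "f n \<in> measurable (restrict_space borel X) (restrict_space borel X)"
    using f[of n] borel_measurable_continuous_on_restrict[of X "f n"]
    by (intro measurable_restrict_space2) (auto simp: space_restrict_space)
  ultimately show ?case using Suc \<mu> by (simp add: push_seq_def distr_distr o_def)
qed

lemma integral_comp_seq_push_seq: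
  fixes \<phi> :: "'a::topological_space \<Rightarrow> real"
  assumes f: "\<And>n. continuous_on X (f n)" "\<And>n. f n ` X \<subseteq> X" and \<mu>: "\<mu> \<in> prob_measures X"
    and \<phi>: "continuous_on X \<phi>"
  shows "(\<integral>x. \<phi> x \<partial>(comp_seq (push_seq X f) n \<mu>)) = (\<integral>x. \<phi> (comp_seq f n x) \<partial>\<mu>)"
  unfolding comp_seq_push_seq[OF f \<mu>]
  by (intro integral_distr measurable_self_map comp_seq_continuous_self_map f \<mu>
      borel_measurable_continuous_on_restrict \<phi>)

section \<open>From measures to points by Dirac measures\<close>

lemma positive_on_relatively_open:
  fixes X :: "'a::metric_space set"
  assumes "openin (top_of_set X) U"
  obtains \<phi> :: "'a \<Rightarrow> real" where "continuous_on X \<phi>" "\<And>x. \<phi> x \<ge> 0" "\<And>x. x \<in> X \<Longrightarrow> \<phi> x > 0 \<longleftrightarrow> x \<in> U"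
proof -
  obtain S where S: "open S" "U = X \<inter> S" using assms by (auto simp: openin_open)
  show ?thesis
  \<comment> \<open>\<open>infdist\<close> to the empty set is 0 by convention, so this case takes
    the constant 1 instead.\<close>
  proof (cases "- S = {}")
    case True
    then show ?thesis using S that[of "\<lambda>_. 1"] by auto
  next
    case False
    have "infdist x (- S) > 0 \<longleftrightarrow> x \<in> S" for x
      using in_closed_iff_infdist_zero[of "- S" x] False S(1) infdist_nonneg[of x "- S"]
      by (auto simp: less_le)
    then show ?thesis
      using S by (intro that[of "\<lambda>x. infdist x (- S)"]) (auto intro!: continuous_intros simp: infdist_nonneg)
  qed
qed

text \<open>For functions
  \<open>\<phi>\<^sub>U \<ge> 0\<close> that are positive exactly on \<open>U\<close>, the sets of measures \<open>\<mu>\<close> with \<open>\<integral> \<phi>\<^sub>U d\<mu> > 0\<close>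
  extend a given cover of \<open>X\<close>: they cover all measures since \<open>\<Sum>\<^sub>U \<phi>\<^sub>U > 0\<close>.\<close>
lemma seq_entropy_zero_of_push:
  fixes X :: "'a::metric_space set"
  assumes X: "compact X" and f: "\<And>n. continuous_on X (f n)" "\<And>n. f n ` X \<subseteq> X"
    and zero: "seq_entropy (weak_star_topology X) (push_seq X f) a = 0"
  shows "seq_entropy (top_of_set X) f a = 0"
  unfolding seq_entropy_eq_0_iff
proof (intro ballI allI impI)
  fix \<U> and \<gamma> :: real assume \<U>: "\<U> \<in> open_covers (top_of_set X)" and "\<gamma> > 0"
  have "\<forall>U\<in>\<U>. \<exists>\<phi>::'a \<Rightarrow> real. continuous_on X \<phi> \<and> (\<forall>x. \<phi> x \<ge> 0) \<and> (\<forall>x\<in>X. \<phi> x > 0 \<longleftrightarrow> x \<in> U)"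
    using \<U> positive_on_relatively_open unfolding open_covers_def by (smt (verit) mem_Collect_eq)
  then obtain \<phi> :: "'a set \<Rightarrow> 'a \<Rightarrow> real" where \<phi>: "\<And>U. U \<in> \<U> \<Longrightarrow> continuous_on X (\<phi> U)" "\<And>U x. U \<in> \<U> \<Longrightarrow> \<phi> U x \<ge> 0"
      "\<And>U x. U \<in> \<U> \<Longrightarrow> x \<in> X \<Longrightarrow> \<phi> U x > 0 \<longleftrightarrow> x \<in> U"
    by metis
  define Q where "Q U = {\<mu> \<in> prob_measures X. (\<integral>x. \<phi> U x \<partial>\<mu>) \<in> {0<..}}" for U
  have "\<exists>U\<in>\<U>. \<mu> \<in> Q U" if \<mu>: "\<mu> \<in> prob_measures X" for \<mu>
  proof (rule ccontr)
    assume "\<not> (\<exists>U\<in>\<U>. \<mu> \<in> Q U)"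
    then have le: "(\<integral>x. \<phi> U x \<partial>\<mu>) \<le> 0" if "U \<in> \<U>" for U using that \<mu> by (auto simp: Q_def not_less)
    interpret prob_space \<mu> using prob_measuresD \<mu> by auto
    have int: "integrable \<mu> (\<phi> U)" if "U \<in> \<U>" for U
      using integrable_prob_measures[OF X \<mu> \<phi>(1)[OF that]] .
    have "(\<integral>x. 0 \<partial>\<mu>) < (\<integral>x. (\<Sum>U\<in>\<U>. \<phi> U x) \<partial>\<mu>)"
    proof (rule integral_less_AE_space)
      show "integrable \<mu> (\<lambda>x. \<Sum>U\<in>\<U>. \<phi> U x)" using int by simp
      show "AE x in \<mu>. 0 < (\<Sum>U\<in>\<U>. \<phi> U x)"
      proof (rule AE_I2)
        fix x assume "x \<in> space \<mu>"
        then have "x \<in> X" using prob_measuresD(3)[OF \<mu>] by simp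
        then obtain U where "U \<in> \<U>" "x \<in> U" using \<U> unfolding open_covers_def by auto
        then show "0 < (\<Sum>U\<in>\<U>. \<phi> U x)"
          using \<U> \<phi> \<open>x \<in> X\<close> by (intro sum_pos2[of _ U]) (auto simp: open_covers_def)
      qed
      show "integrable \<mu> (\<lambda>x. 0::real)" by simp
      show "emeasure \<mu> (space \<mu>) \<noteq> 0" using emeasure_space_1 by simp
    qed
    moreover have "(\<integral>x. (\<Sum>U\<in>\<U>. \<phi> U x) \<partial>\<mu>) = (\<Sum>U\<in>\<U>. \<integral>x. \<phi> U x \<partial>\<mu>)" using int by simp
    moreover have "\<dots> \<le> 0" using le by (intro sum_nonpos) auto
    ultimately show False by simp
  qed
  then have Q: "Q ` \<U> \<in> open_covers (weak_star_topology X)"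
    using \<U> \<phi>(1) openin_weak_star_integral[of X _ "{0<..}"]
    by (auto simp: open_covers_def Q_def)
  let ?R = "restrict_space borel X"
  \<comment> \<open>The map \<open>e\<close> is the Dirac embedding. As \<open>Q\<close> may fail to
    be injective, \<open>w\<close> picks one preimage; any serves, since a Dirac measure at
    \<open>x\<close> lies in \<open>Q U\<close> exactly when \<open>\<phi> U x > 0\<close>, that is,
    when \<open>x\<close> lies in \<open>U\<close>.\<close>
  define e where "e = return ?R"
  define w where "w V = (SOME U. U \<in> \<U> \<and> Q U = V)" for V
  have w: "w V \<in> \<U>" "Q (w V) = V" if "V \<in> Q ` \<U>" for V
    unfolding w_def using someI_ex[of "\<lambda>U. U \<in> \<U> \<and> Q U = V"] that by auto
  have "min_subcover (top_of_set X) (join_cover (top_of_set X) f a \<U> n)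
      \<le> min_subcover (weak_star_topology X) (join_cover (weak_star_topology X) (push_seq X f) a (Q ` \<U>) n)" for n
  proof (rule min_subcover_join_mono[OF Q, where e=e and w=w])
    show "push_seq X f n y \<in> topspace (weak_star_topology X)" if "y \<in> topspace (weak_star_topology X)" for n y
      using push_seq_in_prob_measures[of y X f n] f that by auto
    show "f n x \<in> topspace (top_of_set X)" if "x \<in> topspace (top_of_set X)" for n x
      using that f(2)[of n] by auto
    show "e x \<in> topspace (weak_star_topology X)" if "x \<in> topspace (top_of_set X)" for x
      using that by (auto simp: e_def prob_measures_def space_restrict_space intro!: prob_space_return)
    show "e (f n x) = push_seq X f n (e x)" if "x \<in> topspace (top_of_set X)" for n x
    proof -
      have "f n \<in> measurable ?R ?R"
        using f[of n] borel_measurable_continuous_on_restrict[of X "f n"]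
        by (intro measurable_restrict_space2) (auto simp: space_restrict_space)
      then show ?thesis using that
        unfolding push_seq_def e_def by (subst distr_return) (auto simp: space_restrict_space)
    qed
    show "w V \<in> \<U>" if "V \<in> Q ` \<U>" for V using w that by auto
    show "x \<in> w V" if "V \<in> Q ` \<U>" "x \<in> topspace (top_of_set X)" "e x \<in> V" for V x
    proof -
      have "e x \<in> Q (w V)" using w that by auto
      then have "(\<integral>y. \<phi> (w V) y \<partial>e x) > 0" by (auto simp: Q_def)
      moreover have "(\<integral>y. \<phi> (w V) y \<partial>e x) = \<phi> (w V) x"
        unfolding e_def using that w \<phi>(1)
        by (intro integral_return borel_measurable_continuous_on_restrict) (auto simp: space_restrict_space)
      ultimately show ?thesis using \<phi>(3) w that by auto
    qed
  qed
  then have "ln (real (min_subcover (top_of_set X) (join_cover (top_of_set X) f a \<U> n))) / real n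
     \<le> ln (real (min_subcover (weak_star_topology X) (join_cover (weak_star_topology X) (push_seq X f) a (Q ` \<U>) n))) / real n" for n
    by (intro divide_right_mono ln_real_nat_mono) auto
  moreover have "\<forall>\<^sub>F n in sequentially. ln (real (min_subcover (weak_star_topology X)
       (join_cover (weak_star_topology X) (push_seq X f) a (Q ` \<U>) n))) / real n < \<gamma>"
    using zero Q \<open>\<gamma> > 0\<close> unfolding seq_entropy_eq_0_iff by blast
  ultimately show "\<forall>\<^sub>F n in sequentially. ln (real (min_subcover (top_of_set X)
       (join_cover (top_of_set X) f a \<U> n))) / real n < \<gamma>"
    by (auto elim!: eventually_mono intro: order_le_less_trans)
qed

subsection \<open>Compactness of the space of measures\<close>

text \<open>A sequence of Borel sets \<open>B\<close> separating points at every scale codes \<open>X\<close> by binary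
  sequences. A measure is determined by the masses of its cells, and conversely consistent
  masses \<open>p\<close> come from a measure: cut \<open>[0,1)\<close> into nested intervals of lengths \<open>p s\<close> and
  send \<open>t\<close> to the limit of points in the cells whose intervals contain \<open>t\<close>. Thus the space
  of measures is a quotient of a closed subset of the compact product of unit intervals.\<close>

locale cell_structure =
  fixes X :: "'a::metric_space set" and B :: "nat \<Rightarrow> 'a set"
  assumes compact_X: "compact X"
    and B_borel: "\<And>i. B i \<in> sets borel"
    and B_small: "\<And>e. e > 0 \<Longrightarrow> \<exists>m. \<forall>x\<in>X. \<exists>i<m. x \<in> B i \<and> (\<forall>y\<in>B i. dist x y < e)"
begin

text \<open>Codes are stored with the most recent bit first.\<close>

primrec cell :: "bool list \<Rightarrow> 'a set" where
  "cell [] = X"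
| "cell (b # s) = {x \<in> cell s. (x \<in> B (length s)) = b}"

primrec code :: "'a \<Rightarrow> nat \<Rightarrow> bool list" where
  "code x 0 = []"
| "code x (Suc k) = (x \<in> B k) # code x k"

lemma length_code [simp]: "length (code x k) = k"
  by (induction k) auto

lemma cell_iff_code: "x \<in> cell s \<longleftrightarrow> x \<in> X \<and> code x (length s) = s"
  by (induction s) auto

lemma code_eq_imp: "code x k = code y k \<Longrightarrow> i < k \<Longrightarrow> x \<in> B i \<longleftrightarrow> y \<in> B i"
  by (induction k) (auto simp: less_Suc_eq)

lemma cell_subset: "cell s \<subseteq> X"
  by (auto simp: cell_iff_code)

text \<open>Points of a common cell of depth at least \<open>m\<close> agree on membership in every
  \<open>B i\<close> with \<open>i < m\<close>, and one of these sets contains \<open>x\<close> and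
  lies within \<open>e\<close> of it.\<close>

lemma cell_small:
  assumes "e > 0"
  obtains m where "\<And>s x y. m \<le> length s \<Longrightarrow> x \<in> cell s \<Longrightarrow> y \<in> cell s \<Longrightarrow> dist x y < e"
proof -
  obtain m where m: "\<forall>x\<in>X. \<exists>i<m. x \<in> B i \<and> (\<forall>y\<in>B i. dist x y < e)"
    using B_small[OF assms] by auto
  have "dist x y < e" if s: "m \<le> length s" "x \<in> cell s" "y \<in> cell s" for s x y
  proof -
    obtain i where i: "i < m" "x \<in> B i" "\<forall>y\<in>B i. dist x y < e" using m s by (auto simp: cell_iff_code)
    have "code x (length s) = code y (length s)" using s by (auto simp: cell_iff_code)
    from code_eq_imp[OF this, of i] i s show ?thesis by auto
  qed
  then show ?thesis using that by blast
qed

definition pt :: "bool list \<Rightarrow> 'a" where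
  "pt s = (SOME x. x \<in> cell s)"

lemma pt_in: "cell s \<noteq> {} \<Longrightarrow> pt s \<in> cell s"
  unfolding pt_def using some_in_eq by blast

text \<open>Uniform continuity on small cells. Closures are included because the limit points
  constructed below lie only in closures of cells; radius \<open>d/2\<close> leaves room for the
  non-strict bound that passing to the closure gives.\<close>

lemma uniform_modulus:
  fixes \<phi> :: "'a \<Rightarrow> real"
  assumes "continuous_on X \<phi>" "\<eta> > 0"
  obtains m where
    "\<And>s x. m \<le> length s \<Longrightarrow> cell s \<noteq> {} \<Longrightarrow> x \<in> X \<Longrightarrow> x \<in> closure (cell s) \<Longrightarrow> \<bar>\<phi> x - \<phi> (pt s)\<bar> \<le> \<eta>"
proof -
  obtain d where d: "d > 0" "\<And>x y. x \<in> X \<Longrightarrow> y \<in> X \<Longrightarrow> dist y x < d \<Longrightarrow> dist (\<phi> y) (\<phi> x) < \<eta>"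
    using compact_uniformly_continuous[OF assms(1) compact_X] assms(2)
    unfolding uniformly_continuous_on_def by metis
  obtain m where m: "\<And>s x y. m \<le> length s \<Longrightarrow> x \<in> cell s \<Longrightarrow> y \<in> cell s \<Longrightarrow> dist x y < d/2"
    using cell_small[of "d/2"] d by auto
  have "\<bar>\<phi> x - \<phi> (pt s)\<bar> \<le> \<eta>"
    if "m \<le> length s" "cell s \<noteq> {}" "x \<in> X" "x \<in> closure (cell s)" for s x
  proof -
    have "closure (cell s) \<subseteq> cball (pt s) (d/2)"
      using m[OF that(1) pt_in[OF that(2)]] by (intro closure_minimal subsetI) (simp_all add: less_imp_le)
    then have "dist x (pt s) < d" using that d(1) by (auto simp: dist_commute)
    then have "dist (\<phi> x) (\<phi> (pt s)) < \<eta>" using d(2) that pt_in cell_subset by blast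
    then show ?thesis by (simp add: dist_real_def)
  qed
  then show ?thesis using that by blast
qed

text \<open>These are consistent systems of cell probabilities. Giving empty cells mass 0 ensures
  that no parameter in \<open>[0,1)\<close> is ever assigned to an empty cell.\<close>

definition masses :: "(bool list \<Rightarrow> real) set" where
  "masses = {p. p [] = 1 \<and> (\<forall>s. p s \<in> {0..1}) \<and> (\<forall>s. p s = p (False # s) + p (True # s)) \<and>
     (\<forall>s. cell s = {} \<longrightarrow> p s = 0)}"

lemma massesD:
  assumes "p \<in> masses"
  shows "p [] = 1" "0 \<le> p s" "p s \<le> 1" "p s = p (False # s) + p (True # s)" "cell s = {} \<Longrightarrow> p s = 0"
proof -
  have *: "p [] = 1 \<and> (\<forall>s. p s \<in> {0..1}) \<and> (\<forall>s. p s = p (False # s) + p (True # s)) \<and>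
     (\<forall>s. cell s = {} \<longrightarrow> p s = 0)"
    using assms unfolding masses_def by (rule CollectD)
  then have "p s \<in> {0..1}" by blast
  then show "0 \<le> p s" "p s \<le> 1" by simp_all
  show "p [] = 1" "p s = p (False # s) + p (True # s)" "cell s = {} \<Longrightarrow> p s = 0"
    using * by blast+
qed

text \<open>Tychonoff's theorem makes the cube compact, and each further condition is an equation in
  finitely many coordinates, hence closed.\<close>

lemma compact_masses: "compact masses"
proof -
  have "compactin (product_topology (\<lambda>i. euclidean) UNIV) (PiE UNIV (\<lambda>_::bool list. {0..1::real}))"
    by (simp add: compactin_PiE)
  then have c: "compact (PiE UNIV (\<lambda>_::bool list. {0..1::real}))"
    by (simp add: euclidean_product_topology)
  have eq: "masses = PiE UNIV (\<lambda>_. {0..1}) \<inter> ({p. p [] = 1} \<inter>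
     (\<Inter>s. {p. p s = p (False # s) + p (True # s)}) \<inter> (\<Inter>s\<in>{s. cell s = {}}. {p. p s = 0}))"
    unfolding masses_def PiE_UNIV_domain Pi_def by blast
  have cl: "closed ({p. p [] = 1} \<inter>
     (\<Inter>s. {p. p s = p (False # s) + p (True # s)}) \<inter> (\<Inter>s\<in>{s. cell s = {}}. {p. p s = (0::real)}))"
  proof -
    have coord: "continuous_on UNIV (\<lambda>p. p s :: real)" for s :: "bool list"
      by simp
    have A: "closed {p. p s = p (False # s) + (p (True # s) :: real)}" for s
      using closed_Collect_eq[OF coord continuous_on_add[OF coord coord]] .
    have B: "closed {p. p s = c}" for s :: "bool list" and c :: real
      using closed_Collect_eq[OF coord continuous_on_const] .
    show ?thesis
      by (rule closed_Int[OF closed_Int[OF B closed_INT] closed_INT]; rule ballI; rule A B)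
  qed
  show ?thesis unfolding eq by (rule compact_Int_closed[OF c cl])
qed

text \<open>The interval of \<open>s\<close> runs from \<open>left p s\<close> to
  \<open>left p s + p s\<close>, closed on the left and open on the right, so that each parameter
  has exactly one code per depth. The \<open>False\<close> child takes the left part of its
  parent.\<close>

primrec left :: "(bool list \<Rightarrow> real) \<Rightarrow> bool list \<Rightarrow> real" where
  "left p [] = 0"
| "left p (b # s) = (if b then left p s + p (False # s) else left p s)"

primrec digits :: "(bool list \<Rightarrow> real) \<Rightarrow> real \<Rightarrow> nat \<Rightarrow> bool list" where
  "digits p t 0 = []"
| "digits p t (Suc k) = (left p (digits p t k) + p (False # digits p t k) \<le> t) # digits p t k"

lemma length_digits [simp]: "length (digits p t k) = k"
  by (induction k) auto

lemma digits_iff: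
  assumes "p \<in> masses" "t \<in> {0..<1}"
  shows "digits p t (length s) = s \<longleftrightarrow> t \<in> {left p s..<left p s + p s}"
proof (induction s)
  case Nil
  then show ?case using assms(2) massesD(1)[OF assms(1)] by auto
next
  case (Cons b s)
  have "digits p t (length (b # s)) = b # s \<longleftrightarrow>
      digits p t (length s) = s \<and> (left p s + p (False # s) \<le> t) = b"
    by auto
  also have "\<dots> \<longleftrightarrow> t \<in> {left p (b # s)..<left p (b # s) + p (b # s)}"
    unfolding Cons
    using massesD(4)[OF assms(1), of s] massesD(2)[OF assms(1), of "True # s"]
      massesD(2)[OF assms(1), of "False # s"]
    by (cases b) auto
  finally show ?case .
qed

lemma left_bounds:
  assumes "p \<in> masses"
  shows "0 \<le> left p s \<and> left p s + p s \<le> 1"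
proof (induction s)
  case Nil
  then show ?case using massesD(1)[OF assms] by simp
next
  case (Cons b s)
  then show ?case
    using massesD(4)[OF assms, of s] massesD(2)[OF assms, of "True # s"] massesD(2)[OF assms, of "False # s"]
    by auto
qed

text \<open>The interval of the code of \<open>t\<close> contains \<open>t\<close>, so it has
  positive length, whereas empty cells carry mass 0.\<close>

lemma cell_digits_nonempty:
  assumes "p \<in> masses" "t \<in> {0..<1}"
  shows "cell (digits p t k) \<noteq> {}"
  using digits_iff[OF assms, of "digits p t k"] massesD(5)[OF assms(1), of "digits p t k"] by auto

lemma cell_digits_antimono: "j \<le> k \<Longrightarrow> cell (digits p t k) \<subseteq> cell (digits p t j)"
  by (induction k rule: dec_induct) auto

definition unif :: "real measure" where
  "unif = restrict_space lborel {0..<1}"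

lemma space_unif [simp]: "space unif = {0..<1}"
  by (simp add: unif_def space_restrict_space)

lemma prob_space_unif: "prob_space unif"
  by (rule prob_spaceI) (simp add: unif_def emeasure_restrict_space space_restrict_space)

lemma digits_vimage:
  assumes "p \<in> masses"
  shows "{t \<in> space unif. digits p t k = s} = (if length s = k then {left p s..<left p s + p s} else {})"
  using digits_iff[OF assms, of _ s] left_bounds[OF assms, of s] by auto

lemma measurable_digits:
  assumes "p \<in> masses"
  shows "(\<lambda>t. digits p t k) \<in> measurable unif (count_space UNIV)"
proof -
  have "(\<lambda>t. digits p t k) -` {s} \<inter> space unif \<in> sets unif" for s
  proof -
    have "(\<lambda>t. digits p t k) -` {s} \<inter> space unif = {t \<in> space unif. digits p t k = s}" by auto
    also have "\<dots> \<in> sets unif"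
      unfolding digits_vimage[OF assms] using left_bounds[OF assms, of s]
      by (auto simp: unif_def sets_restrict_space_iff)
    finally show ?thesis .
  qed
  then show ?thesis by (subst measurable_count_space_eq2_countable) auto
qed

lemma measure_digits:
  assumes "p \<in> masses" "length s = k"
  shows "measure unif {t \<in> space unif. digits p t k = s} = p s"
  unfolding digits_vimage[OF assms(1)]
  using assms massesD(2)[OF assms(1), of s] left_bounds[OF assms(1), of s]
  by (auto simp: unif_def measure_restrict_space)

definition lim_pt :: "(bool list \<Rightarrow> real) \<Rightarrow> real \<Rightarrow> 'a" where
  "lim_pt p t = lim (\<lambda>k. pt (digits p t k))"

text \<open>The cells coded by \<open>t\<close> are nested and shrink, so their sample points form a
  Cauchy sequence. Cells need not be closed, hence the limit is placed only in their
  closures.\<close>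

lemma lim_pt:
  assumes "p \<in> masses" "t \<in> {0..<1}"
  shows "(\<lambda>k. pt (digits p t k)) \<longlonglongrightarrow> lim_pt p t" "lim_pt p t \<in> X"
    "lim_pt p t \<in> closure (cell (digits p t k))"
proof -
  have in_cell: "pt (digits p t k) \<in> cell (digits p t j)" if "j \<le> k" for j k
    using pt_in[OF cell_digits_nonempty[OF assms]] cell_digits_antimono[OF that] by blast
  have "Cauchy (\<lambda>k. pt (digits p t k))"
  proof (rule metric_CauchyI)
    fix e :: real assume "e > 0"
    then obtain m where m: "\<And>s x y. m \<le> length s \<Longrightarrow> x \<in> cell s \<Longrightarrow> y \<in> cell s \<Longrightarrow> dist x y < e"
      using cell_small by metis
    show "\<exists>M. \<forall>i\<ge>M. \<forall>j\<ge>M. dist (pt (digits p t i)) (pt (digits p t j)) < e"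
      using m[of "digits p t m"] in_cell by (intro exI[of _ m]) auto
  qed
  moreover have "\<forall>k. pt (digits p t k) \<in> X" using in_cell cell_subset by blast
  ultimately obtain l where l: "l \<in> X" "(\<lambda>k. pt (digits p t k)) \<longlonglongrightarrow> l"
    using compact_imp_complete[OF compact_X, unfolded complete_def, rule_format, of "\<lambda>k. pt (digits p t k)"]
    by auto
  then have eq: "lim_pt p t = l" unfolding lim_pt_def by (intro limI)
  show "(\<lambda>k. pt (digits p t k)) \<longlonglongrightarrow> lim_pt p t" "lim_pt p t \<in> X" using l eq by auto
  show "lim_pt p t \<in> closure (cell (digits p t k))"
    unfolding eq
  proof (rule Lim_in_closed_set[OF closed_closure _ _ l(2)])
    show "\<forall>\<^sub>F j in sequentially. pt (digits p t j) \<in> closure (cell (digits p t k))"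
      using eventually_ge_at_top[of k] by eventually_elim (meson in_cell closure_subset subsetD)
  qed simp
qed

lemma measurable_lim_pt:
  assumes "p \<in> masses"
  shows "lim_pt p \<in> measurable unif (restrict_space borel X)"
proof (rule measurable_restrict_space2)
  show "lim_pt p \<in> space unif \<rightarrow> X" using lim_pt(2)[OF assms] by auto
  show "lim_pt p \<in> borel_measurable unif"
  proof (rule borel_measurable_LIMSEQ_metric)
    show "(\<lambda>t. pt (digits p t k)) \<in> borel_measurable unif" for k
      using measurable_compose[OF measurable_digits[OF assms], of pt borel k] by simp
    show "(\<lambda>k. pt (digits p t k)) \<longlonglongrightarrow> lim_pt p t" if "t \<in> space unif" for t
      using lim_pt(1)[OF assms] that by simp
  qed
qed

definition measure_of_masses :: "(bool list \<Rightarrow> real) \<Rightarrow> 'a measure" where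
  "measure_of_masses p = distr unif (restrict_space borel X) (lim_pt p)"

lemma measure_of_masses_in: "p \<in> masses \<Longrightarrow> measure_of_masses p \<in> prob_measures X"
  using prob_space.prob_space_distr[OF prob_space_unif measurable_lim_pt]
  by (simp add: prob_measures_def measure_of_masses_def)

text \<open>Stated for a general code \<open>D\<close> and point map \<open>Y\<close> to serve
  twice: for \<open>unif\<close> with \<open>digits\<close> and \<open>lim_pt\<close>, and for a
  given measure on \<open>X\<close> with \<open>code\<close> and the identity.\<close>

lemma integral_approx_cells:
  fixes \<phi> :: "'a \<Rightarrow> real"
  assumes "prob_space N" and D: "D \<in> measurable N (count_space UNIV)"
    and len: "\<And>t. t \<in> space N \<Longrightarrow> length (D t) = k"
    and meas: "(\<lambda>t. \<phi> (Y t)) \<in> borel_measurable N"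
    and close: "\<And>t. t \<in> space N \<Longrightarrow> \<bar>\<phi> (Y t) - \<phi> (pt (D t))\<bar> \<le> \<eta>"
  shows "\<bar>(\<integral>t. \<phi> (Y t) \<partial>N) - (\<Sum>s | length s = k. measure N {t \<in> space N. D t = s} * \<phi> (pt s))\<bar> \<le> \<eta>"
proof -
  interpret prob_space N by fact
  have fin: "finite {s :: bool list. length s = k}"
    using finite_lists_length_eq[of "UNIV :: bool set" k] by simp
  have sets: "{t \<in> space N. D t = s} \<in> sets N" for s
    using measurable_sets[OF D, of "{s}"] by (simp add: vimage_def Int_def conj_commute)
  define S where "S t = (\<Sum>s | length s = k. indicator {t \<in> space N. D t = s} t * \<phi> (pt s))" for t
  have S: "S t = \<phi> (pt (D t))" if "t \<in> space N" for t
  proof -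
    have "S t = (\<Sum>s | length s = k. if s = D t then \<phi> (pt (D t)) else 0)"
      unfolding S_def using that by (intro sum.cong) (auto simp: indicator_def)
    also have "\<dots> = \<phi> (pt (D t))" using fin len[OF that] by simp
    finally show ?thesis .
  qed
  have intS: "integrable N S" unfolding S_def
    using sets by (intro Bochner_Integration.integrable_sum) (auto simp: emeasure_eq_measure)
  have "(\<integral>t. S t \<partial>N) = (\<Sum>s | length s = k. measure N {t \<in> space N. D t = s} * \<phi> (pt s))"
    unfolding S_def using sets
    by (subst Bochner_Integration.integral_sum) (auto simp: emeasure_eq_measure Int_absorb1)
  \<comment> \<open>The difference is bounded by \<open>\<eta>\<close> and \<open>S\<close> is a
    finite sum of indicators; together they make \<open>\<phi> (Y t)\<close> integrable without a
    bound on \<open>\<phi>\<close>.\<close>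
  moreover have "integrable N (\<lambda>t. \<phi> (Y t) - S t)"
    using close S meas intS by (intro integrable_const_bound[of _ \<eta>]) auto
  then have "integrable N (\<lambda>t. \<phi> (Y t))" using Bochner_Integration.integrable_add[OF _ intS, of "\<lambda>t. \<phi> (Y t) - S t"] by simp
  moreover have "\<bar>\<integral>t. (\<phi> (Y t) - S t) \<partial>N\<bar> \<le> \<eta>"
  proof -
    have "\<bar>\<integral>t. (\<phi> (Y t) - S t) \<partial>N\<bar> \<le> (\<integral>t. \<bar>\<phi> (Y t) - S t\<bar> \<partial>N)"
      by (rule integral_abs_bound)
    also have "\<dots> \<le> (\<integral>t. \<eta> \<partial>N)"
      using close S \<open>integrable N (\<lambda>t. \<phi> (Y t) - S t)\<close> by (intro integral_mono) auto
    finally show ?thesis by (simp add: prob_space)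
  qed
  ultimately show ?thesis using intS by simp
qed

lemma integral_measure_of_masses_approx:
  fixes \<phi> :: "'a \<Rightarrow> real"
  assumes "continuous_on X \<phi>" "\<eta> > 0"
  obtains m where "\<And>k p. m \<le> k \<Longrightarrow> p \<in> masses \<Longrightarrow>
      \<bar>(\<integral>x. \<phi> x \<partial>measure_of_masses p) - (\<Sum>s | length s = k. p s * \<phi> (pt s))\<bar> \<le> \<eta>"
proof -
  obtain m where m: "\<And>s x. m \<le> length s \<Longrightarrow> cell s \<noteq> {} \<Longrightarrow> x \<in> X \<Longrightarrow> x \<in> closure (cell s) \<Longrightarrow> \<bar>\<phi> x - \<phi> (pt s)\<bar> \<le> \<eta>"
    using uniform_modulus[OF assms] by blast
  have "\<bar>(\<integral>x. \<phi> x \<partial>measure_of_masses p) - (\<Sum>s | length s = k. p s * \<phi> (pt s))\<bar> \<le> \<eta>"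
    if k: "m \<le> k" and p: "p \<in> masses" for k p
  proof -
    have \<phi>: "\<phi> \<in> borel_measurable (restrict_space borel X)"
      using borel_measurable_continuous_on_restrict[OF assms(1)] .
    have "\<bar>(\<integral>t. \<phi> (lim_pt p t) \<partial>unif) -
        (\<Sum>s | length s = k. measure unif {t \<in> space unif. digits p t k = s} * \<phi> (pt s))\<bar> \<le> \<eta>"
      using k m cell_digits_nonempty[OF p] lim_pt[OF p] measurable_compose[OF measurable_lim_pt[OF p] \<phi>]
      by (intro integral_approx_cells prob_space_unif measurable_digits p) auto
    moreover have "(\<Sum>s | length s = k. measure unif {t \<in> space unif. digits p t k = s} * \<phi> (pt s)) =
        (\<Sum>s | length s = k. p s * \<phi> (pt s))"
      by (intro sum.cong) (auto simp only: measure_digits[OF p] mem_Collect_eq)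
    moreover have "(\<integral>x. \<phi> x \<partial>measure_of_masses p) = (\<integral>t. \<phi> (lim_pt p t) \<partial>unif)"
      unfolding measure_of_masses_def by (intro integral_distr measurable_lim_pt p \<phi>)
    ultimately show ?thesis by simp
  qed
  then show ?thesis using that by blast
qed

text \<open>The approximating sums depend on finitely many coordinates of \<open>p\<close>, and
  their error bound does not depend on \<open>p\<close>, so the integral is a uniform limit of
  continuous functions.\<close>

lemma continuous_on_integral_measure_of_masses:
  fixes \<phi> :: "'a \<Rightarrow> real"
  assumes "continuous_on X \<phi>"
  shows "continuous_on masses (\<lambda>p. \<integral>x. \<phi> x \<partial>measure_of_masses p)"
proof (rule uniform_limit_theorem)
  show "\<forall>\<^sub>F k in sequentially. continuous_on masses (\<lambda>p. \<Sum>s | length s = k. p s * \<phi> (pt s))"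
    by (intro always_eventually allI continuous_on_sum continuous_on_mult_right
        continuous_on_subset[OF continuous_on_product_coordinates] subset_UNIV)
  show "uniform_limit masses (\<lambda>k p. \<Sum>s | length s = k. p s * \<phi> (pt s))
     (\<lambda>p. \<integral>x. \<phi> x \<partial>measure_of_masses p) sequentially"
  proof (rule uniform_limitI)
    fix e :: real assume "e > 0"
    then obtain m where m: "\<And>k p. m \<le> k \<Longrightarrow> p \<in> masses \<Longrightarrow>
      \<bar>(\<integral>x. \<phi> x \<partial>measure_of_masses p) - (\<Sum>s | length s = k. p s * \<phi> (pt s))\<bar> \<le> e/2"
      using integral_measure_of_masses_approx[OF assms, of "e/2"] by auto
    show "\<forall>\<^sub>F k in sequentially. \<forall>p\<in>masses.
        dist (\<Sum>s | length s = k. p s * \<phi> (pt s)) (\<integral>x. \<phi> x \<partial>measure_of_masses p) < e"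
      using eventually_ge_at_top[of m]
    proof eventually_elim
      case (elim k)
      show ?case
      proof
        fix p assume "p \<in> masses"
        with m[OF elim this] \<open>e > 0\<close>
        show "dist (\<Sum>s | length s = k. p s * \<phi> (pt s)) (\<integral>x. \<phi> x \<partial>measure_of_masses p) < e"
          unfolding dist_real_def by linarith
      qed
    qed
  qed
qed simp

lemma cell_sets: "cell s \<in> sets (restrict_space borel X)"
proof (induction s)
  case Nil
  then show ?case by (metis cell.simps(1) sets.top space_restrict_space2 space_borel UNIV_I
        space_restrict_space Int_UNIV_right inf_commute)
next
  case (Cons b s)
  have "X \<inter> B (length s) \<in> sets (restrict_space borel X)"
    using B_borel by (auto simp: sets_restrict_space)
  moreover have "cell (b # s) = (if b then cell s \<inter> (X \<inter> B (length s)) else cell s - (X \<inter> B (length s)))"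
    using cell_subset[of s] by auto
  ultimately show ?case using Cons by auto
qed

text \<open>Take \<open>p\<close> to be the masses that \<open>\<mu>\<close> gives to the cells:
  both integrals are then close to the same finite sum. Equality of integrals suffices, since the
  topology sees measures only through them.\<close>

lemma measure_of_masses_surj:
  assumes \<mu>: "\<mu> \<in> prob_measures X"
  obtains p where "p \<in> masses"
    "\<And>\<phi> :: 'a \<Rightarrow> real. continuous_on X \<phi> \<Longrightarrow> (\<integral>x. \<phi> x \<partial>measure_of_masses p) = (\<integral>x. \<phi> x \<partial>\<mu>)"
proof -
  interpret prob_space \<mu> using prob_measuresD(1)[OF \<mu>] .
  note sp = prob_measuresD(3)[OF \<mu>]
  have ev: "cell s \<in> events" for s using cell_sets prob_measuresD(2)[OF \<mu>] by simp
  define p where "p s = prob (cell s)" for s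
  have add: "prob (cell s) = prob (cell (False # s)) + prob (cell (True # s))" for s
    by (subst finite_measure_Union[symmetric, OF ev ev]) (auto intro!: arg_cong[where f=prob])
  have p: "p \<in> masses"
    unfolding masses_def p_def mem_Collect_eq
  proof (intro conjI allI impI)
    show "prob (cell []) = 1" using prob_space sp by simp
  qed (fact add | simp)+
  have code_set: "{x \<in> space \<mu>. code x k = s} = (if length s = k then cell s else {})" for k s
    unfolding sp by (auto simp: cell_iff_code)
  have meas_code: "(\<lambda>x. code x k) \<in> measurable \<mu> (count_space UNIV)" for k
  proof -
    have "(\<lambda>x. code x k) -` {s} \<inter> space \<mu> = {x \<in> space \<mu>. code x k = s}" for s by auto
    then have "(\<lambda>x. code x k) -` {s} \<inter> space \<mu> \<in> events" for s using code_set ev by simp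
    then show ?thesis by (subst measurable_count_space_eq2_countable) auto
  qed
  have "(\<integral>x. \<phi> x \<partial>measure_of_masses p) = (\<integral>x. \<phi> x \<partial>\<mu>)" if \<phi>: "continuous_on X \<phi>" for \<phi> :: "'a \<Rightarrow> real"
  proof -
    have "\<bar>(\<integral>x. \<phi> x \<partial>measure_of_masses p) - (\<integral>x. \<phi> x \<partial>\<mu>)\<bar> \<le> 0 + e" if "e > 0" for e
    proof -
      have "e/2 > 0" using that by simp
      obtain m where m: "\<And>k p. m \<le> k \<Longrightarrow> p \<in> masses \<Longrightarrow>
          \<bar>(\<integral>x. \<phi> x \<partial>measure_of_masses p) - (\<Sum>s | length s = k. p s * \<phi> (pt s))\<bar> \<le> e/2"
        using integral_measure_of_masses_approx[OF \<phi> \<open>e/2 > 0\<close>] by blast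
      obtain m' where m': "\<And>s x. m' \<le> length s \<Longrightarrow> cell s \<noteq> {} \<Longrightarrow> x \<in> X \<Longrightarrow> x \<in> closure (cell s) \<Longrightarrow> \<bar>\<phi> x - \<phi> (pt s)\<bar> \<le> e/2"
        using uniform_modulus[OF \<phi> \<open>e/2 > 0\<close>] by blast
      define k where "k = max m m'"
      have "\<bar>(\<integral>x. \<phi> x \<partial>\<mu>) - (\<Sum>s | length s = k. prob {x \<in> space \<mu>. code x k = s} * \<phi> (pt s))\<bar> \<le> e/2"
      proof (rule integral_approx_cells[OF prob_space_axioms meas_code _ borel_measurable_prob_measures[OF \<mu> \<phi>]])
        fix x assume "x \<in> space \<mu>"
        then have x: "x \<in> cell (code x k)" "x \<in> X" by (auto simp: cell_iff_code sp)
        then show "\<bar>\<phi> x - \<phi> (pt (code x k))\<bar> \<le> e/2"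
          using m'[of "code x k" x] closure_subset[of "cell (code x k)"] by (auto simp: k_def)
      qed auto
      moreover have "(\<Sum>s | length s = k. prob {x \<in> space \<mu>. code x k = s} * \<phi> (pt s)) =
          (\<Sum>s | length s = k. p s * \<phi> (pt s))"
        unfolding code_set p_def by (intro sum.cong) auto
      moreover have "m \<le> k" by (simp add: k_def)
      ultimately show ?thesis using m[OF \<open>m \<le> k\<close> p] by linarith
    qed
    then have "\<bar>(\<integral>x. \<phi> x \<partial>measure_of_masses p) - (\<integral>x. \<phi> x \<partial>\<mu>)\<bar> \<le> 0"
      by (rule field_le_epsilon)
    then show ?thesis by simp
  qed
  then show ?thesis using that p by blast
qed

end

text \<open>Enumerate the balls of radius \<open>1 / (k + 1)\<close> around finite nets, for all
  \<open>k\<close>. Nonemptiness of \<open>X\<close> makes this family nonempty, as its enumeration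
  by \<open>from_nat_into\<close> requires.\<close>

lemma ex_cell_structure:
  fixes X :: "'a::metric_space set"
  assumes "compact X" "X \<noteq> {}"
  shows "\<exists>B. cell_structure X B"
proof -
  have "\<exists>C. finite C \<and> X \<subseteq> (\<Union>c\<in>C. ball c (1 / real (Suc k)))" for k
    using seq_compact_imp_totally_bounded[OF compact_imp_seq_compact[OF assms(1)], rule_format, of "1 / real (Suc k)"]
    by auto
  then obtain C where C: "\<And>k. finite (C k)" "\<And>k. X \<subseteq> (\<Union>c\<in>C k. ball c (1 / real (Suc k)))" by metis
  define \<B> where "\<B> = (\<Union>k. (\<lambda>c. ball c (1 / real (Suc k))) ` C k)"
  have "countable \<B>" unfolding \<B>_def using C(1) by (auto intro: countable_finite)
  moreover have "\<B> \<noteq> {}" unfolding \<B>_def using C(2)[of 0] assms(2) by auto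
  ultimately have range: "range (from_nat_into \<B>) = \<B>" by (intro range_from_nat_into)
  have "cell_structure X (from_nat_into \<B>)"
  proof
    show "from_nat_into \<B> i \<in> sets borel" for i
      using range by (metis (no_types, lifting) UN_iff \<B>_def borel_open image_iff open_ball rangeI)
    fix e :: real assume "e > 0"
    then obtain k where k: "1 / real (Suc k) < e/2" using nat_approx_posE[of "e/2"] by (metis half_gt_zero)
    have "\<forall>c\<in>C k. \<exists>i. from_nat_into \<B> i = ball c (1 / real (Suc k))"
    proof
      fix c assume "c \<in> C k"
      then have "ball c (1 / real (Suc k)) \<in> \<B>" unfolding \<B>_def by blast
      then show "\<exists>i. from_nat_into \<B> i = ball c (1 / real (Suc k))" using range by (metis rangeE)
    qed
    then obtain i where i: "\<And>c. c \<in> C k \<Longrightarrow> from_nat_into \<B> (i c) = ball c (1 / real (Suc k))" by metis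
    obtain m where m: "\<And>c. c \<in> C k \<Longrightarrow> i c < m"
      using finite_nat_set_iff_bounded[of "i ` C k"] C(1) by auto
    show "\<exists>m. \<forall>x\<in>X. \<exists>i<m. x \<in> from_nat_into \<B> i \<and> (\<forall>y\<in>from_nat_into \<B> i. dist x y < e)"
    proof (rule exI[of _ m], rule ballI)
      fix x assume "x \<in> X"
      then obtain c where c: "c \<in> C k" "dist c x < 1 / real (Suc k)" using C(2)[of k] by auto
      show "\<exists>i<m. x \<in> from_nat_into \<B> i \<and> (\<forall>y\<in>from_nat_into \<B> i. dist x y < e)"
      proof (intro exI[of _ "i c"] conjI ballI)
        show "i c < m" using m c by simp
        show "x \<in> from_nat_into \<B> (i c)" using i[OF c(1)] c(2) by simp
        fix y assume "y \<in> from_nat_into \<B> (i c)"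
        then have "dist c y < 1 / real (Suc k)" using i c by simp
        then show "dist x y < e" using c k dist_triangle2[of x y c] by (simp add: dist_commute)
      qed
    qed
  qed (fact assms)
  then show ?thesis by (intro exI[of "cell_structure X" "from_nat_into \<B>"])
qed

section \<open>Lebesgue numbers for covers of the space of measures\<close>

lemma weak_star_neighbourhood:
  assumes "openin (weak_star_topology X) U" "\<mu> \<in> U"
  obtains F :: "('a::topological_space \<Rightarrow> real) set" and \<epsilon> :: real
  where "finite F" "\<And>\<phi>. \<phi> \<in> F \<Longrightarrow> continuous_on X \<phi>" "\<epsilon> > 0"
    "\<And>\<nu>. \<nu> \<in> prob_measures X \<Longrightarrow> (\<And>\<phi>. \<phi> \<in> F \<Longrightarrow> \<bar>(\<integral>x. \<phi> x \<partial>\<nu>) - (\<integral>x. \<phi> x \<partial>\<mu>)\<bar> < \<epsilon>) \<Longrightarrow> \<nu> \<in> U"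
proof -
  define good where "good F \<epsilon> U \<longleftrightarrow> finite F \<and> (\<forall>\<phi>\<in>F. continuous_on X \<phi>) \<and> (\<epsilon>::real) > 0 \<and>
     (\<forall>\<nu>\<in>prob_measures X. (\<forall>\<phi>\<in>F. \<bar>(\<integral>x. \<phi> x \<partial>\<nu>) - (\<integral>x. \<phi> x \<partial>\<mu>)\<bar> < \<epsilon>) \<longrightarrow> \<nu> \<in> U)"
    for F :: "('a \<Rightarrow> real) set" and \<epsilon> U
  have "generate_topology_on {{\<mu> \<in> prob_measures X. (\<integral>x. \<phi> x \<partial>\<mu>) \<in> U} | \<phi> U.
        continuous_on X (\<phi> :: 'a \<Rightarrow> real) \<and> open U} U"
    using assms(1) unfolding weak_star_topology_def by (simp add: openin_topology_generated_by_iff)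
  then have "\<mu> \<in> U \<Longrightarrow> \<exists>F \<epsilon>. good F \<epsilon> U"
  \<comment> \<open>The generators form a subbasis: an intersection is handled by
    \<open>F \<union> G\<close> and \<open>min \<epsilon> \<delta>\<close>, a union by the data of a
    member containing \<open>\<mu>\<close>.\<close>
  proof (induction rule: generate_topology_on.induct)
    case Empty
    then show ?case by simp
  next
    case (Int U V)
    then obtain F \<epsilon> G \<delta> where "good F \<epsilon> U" "good G \<delta> V" by blast
    then have "good (F \<union> G) (min \<epsilon> \<delta>) (U \<inter> V)" unfolding good_def by auto
    then show ?case by blast
  next
    case (UN K)
    then obtain k F \<epsilon> where "k \<in> K" "good F \<epsilon> k" by blast
    then have "good F \<epsilon> (\<Union>K)" unfolding good_def by blast
    then show ?case by blast
  next
    case (Basis s)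
    then obtain \<phi> :: "'a \<Rightarrow> real" and V where s: "s = {\<mu> \<in> prob_measures X. (\<integral>x. \<phi> x \<partial>\<mu>) \<in> V}"
      "continuous_on X \<phi>" "open V" unfolding mem_Collect_eq by (elim exE conjE)
    then have "(\<integral>x. \<phi> x \<partial>\<mu>) \<in> V" using Basis by simp
    then obtain \<epsilon> where "\<epsilon> > 0" "\<And>y. dist y (\<integral>x. \<phi> x \<partial>\<mu>) < \<epsilon> \<Longrightarrow> y \<in> V"
      using s(3) unfolding open_dist by blast
    then have "good {\<phi>} \<epsilon> s" using s unfolding good_def by (simp add: dist_real_def)
    then show ?case by blast
  qed
  then obtain F \<epsilon> where "good F \<epsilon> U" using assms(2) by blast
  then show ?thesis unfolding good_def by (intro that[of F \<epsilon>]) simp_all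
qed

text \<open>Compactness of \<open>masses\<close> is transferred along
  \<open>measure_of_masses\<close>. The centre \<open>c\<close> is an arbitrary assignment of
  numbers, because it will later consist of averages over sample points.\<close>

lemma weak_star_lebesgue_number:
  fixes X :: "'a::metric_space set"
  assumes "compact X" "X \<noteq> {}" and \<U>: "\<U> \<in> open_covers (weak_star_topology X)"
  obtains F :: "('a \<Rightarrow> real) set" and \<epsilon> :: real
  where "finite F" "\<And>\<phi>. \<phi> \<in> F \<Longrightarrow> continuous_on X \<phi>" "\<epsilon> > 0"
    "\<And>c. \<exists>U\<in>\<U>. \<forall>\<nu>\<in>prob_measures X. (\<forall>\<phi>\<in>F. \<bar>(\<integral>x. \<phi> x \<partial>\<nu>) - c \<phi>\<bar> < \<epsilon>) \<longrightarrow> \<nu> \<in> U"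
proof -
  obtain B where "cell_structure X B" using ex_cell_structure assms by blast
  then interpret cell_structure X B .
  define I where "I \<phi> p = (\<integral>x. \<phi> x \<partial>measure_of_masses p)" for \<phi> :: "'a \<Rightarrow> real" and p
  \<comment> \<open>The doubled radius absorbs the triangle inequality at the end:
    \<open>\<delta>\<close> twice, through \<open>c\<close>, and \<open>\<epsilon> p\<close>
    once.\<close>
  define good where "good p U F \<epsilon> \<longleftrightarrow> U \<in> \<U> \<and> finite F \<and> (\<forall>\<phi>\<in>F. continuous_on X \<phi>) \<and> \<epsilon> > 0 \<and>
      (\<forall>\<nu>\<in>prob_measures X. (\<forall>\<phi>\<in>F. \<bar>(\<integral>x. \<phi> x \<partial>\<nu>) - I \<phi> p\<bar> < 2 * \<epsilon>) \<longrightarrow> \<nu> \<in> U)" for p U F \<epsilon>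
  have "\<exists>U F \<epsilon>. good p U F \<epsilon>" if p: "p \<in> masses" for p
  proof -
    obtain U where U: "U \<in> \<U>" "measure_of_masses p \<in> U"
      using \<U> measure_of_masses_in[OF p] unfolding open_covers_def by auto
    then have "openin (weak_star_topology X) U" using \<U> unfolding open_covers_def by auto
    from weak_star_neighbourhood[OF this U(2)] obtain F \<epsilon> where
      "finite F" "\<And>\<phi>. \<phi> \<in> F \<Longrightarrow> continuous_on X \<phi>" "\<epsilon> > 0"
      "\<And>\<nu>. \<nu> \<in> prob_measures X \<Longrightarrow> (\<And>\<phi>. \<phi> \<in> F \<Longrightarrow> \<bar>(\<integral>x. \<phi> x \<partial>\<nu>) - I \<phi> p\<bar> < \<epsilon>) \<Longrightarrow> \<nu> \<in> U"
      unfolding I_def by metis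
    then show ?thesis
      using U(1) unfolding good_def by (intro exI[of _ U] exI[of _ F] exI[of _ "\<epsilon>/2"]) auto
  qed
  then obtain U F \<epsilon> where "\<And>p. p \<in> masses \<Longrightarrow> good p (U p) (F p) (\<epsilon> p)" by metis
  then have UF: "\<And>p. p \<in> masses \<Longrightarrow> U p \<in> \<U>" "\<And>p. p \<in> masses \<Longrightarrow> finite (F p)"
    "\<And>p \<phi>. p \<in> masses \<Longrightarrow> \<phi> \<in> F p \<Longrightarrow> continuous_on X \<phi>" "\<And>p. p \<in> masses \<Longrightarrow> \<epsilon> p > (0::real)"
    "\<And>p \<nu>. p \<in> masses \<Longrightarrow> \<nu> \<in> prob_measures X \<Longrightarrow> (\<forall>\<phi>\<in>F p. \<bar>(\<integral>x. \<phi> x \<partial>\<nu>) - I \<phi> p\<bar> < 2 * \<epsilon> p) \<Longrightarrow> \<nu> \<in> U p"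
    unfolding good_def by simp_all
  define W where "W p = {q \<in> masses. \<forall>\<phi>\<in>F p. \<bar>I \<phi> q - I \<phi> p\<bar> < \<epsilon> p}" for p
  have "openin (top_of_set masses) (W p)" if "p \<in> masses" for p
  proof -
    have "W p = masses \<inter> (\<Inter>\<phi>\<in>F p. {q \<in> masses. I \<phi> q \<in> ball (I \<phi> p) (\<epsilon> p)})"
      by (auto simp: W_def dist_real_def abs_minus_commute)
    moreover have "openin (top_of_set masses) {q \<in> masses. I \<phi> q \<in> ball (I \<phi> p) (\<epsilon> p)}" if "\<phi> \<in> F p" for \<phi>
      using continuous_openin_preimage_gen[OF continuous_on_integral_measure_of_masses[OF UF(3)[OF \<open>p \<in> masses\<close> that]],
          of "ball (I \<phi> p) (\<epsilon> p)"]
      unfolding I_def[abs_def] by (simp add: vimage_def Int_def)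
    ultimately show ?thesis
      using UF(2)[OF that] by (cases "F p = {}") (auto intro!: openin_Int openin_INT)
  qed
  then have "\<forall>c\<in>W ` masses. openin (top_of_set masses) c" by blast
  moreover have "masses \<subseteq> (\<Union>p\<in>masses. W p)" using UF(4) by (auto simp: W_def)
  ultimately obtain \<D> where "\<D> \<subseteq> W ` masses" "finite \<D>" "masses \<subseteq> \<Union>\<D>"
    using compact_masses[unfolded compact_eq_openin_cover, rule_format, of "W ` masses"] by blast
  then obtain D where D: "D \<subseteq> masses" "finite D" "masses \<subseteq> (\<Union>p\<in>D. W p)"
    using finite_subset_image[of \<D> W masses] by blast
  \<comment> \<open>A Dirac measure shows that the cover has a member \<open>U0\<close>; it serves
    for centres \<open>c\<close> that no measure approximates.\<close>
  obtain x where "x \<in> X" using assms(2) by auto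
  define \<mu>0 where "\<mu>0 = return (restrict_space borel X) x"
  have "\<mu>0 \<in> prob_measures X"
    using \<open>x \<in> X\<close> by (auto simp: \<mu>0_def prob_measures_def space_restrict_space intro!: prob_space_return)
  then obtain U0 where U0: "U0 \<in> \<U>" using \<U> unfolding open_covers_def by auto
  have rep: "\<exists>p\<in>D. \<forall>\<phi>\<in>F p. \<bar>(\<integral>x. \<phi> x \<partial>\<nu>) - I \<phi> p\<bar> < \<epsilon> p" if \<nu>: "\<nu> \<in> prob_measures X" for \<nu>
  proof -
    obtain q where q: "q \<in> masses" "\<And>\<phi>. continuous_on X \<phi> \<Longrightarrow> I \<phi> q = (\<integral>x. \<phi> x \<partial>\<nu>)"
      using measure_of_masses_surj[OF \<nu>] unfolding I_def by metis
    then obtain p where "p \<in> D" "q \<in> W p" using D by blast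
    then show ?thesis using q UF(3)[of p] D(1) unfolding W_def by (intro bexI[of _ p]) auto
  qed
  \<comment> \<open>Inserting 1 keeps the minimum defined without asking whether \<open>D\<close> is
    empty.\<close>
  define \<delta> where "\<delta> = Min (insert 1 (\<epsilon> ` D)) / 2"
  have \<delta>: "\<delta> > 0" "\<And>p. p \<in> D \<Longrightarrow> 2 * \<delta> \<le> \<epsilon> p"
    using D UF(4) unfolding \<delta>_def by auto
  show ?thesis
  proof (rule that[of "\<Union>p\<in>D. F p" \<delta>])
    show "finite (\<Union>p\<in>D. F p)" using D UF(2) by blast
    show "continuous_on X \<phi>" if "\<phi> \<in> (\<Union>p\<in>D. F p)" for \<phi> using that D(1) UF(3) by blast
    fix c
    show "\<exists>V\<in>\<U>. \<forall>\<nu>\<in>prob_measures X. (\<forall>\<phi>\<in>\<Union>p\<in>D. F p. \<bar>(\<integral>x. \<phi> x \<partial>\<nu>) - c \<phi>\<bar> < \<delta>) \<longrightarrow> \<nu> \<in> V"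
    proof (cases "\<exists>\<nu>\<in>prob_measures X. \<forall>\<phi>\<in>\<Union>p\<in>D. F p. \<bar>(\<integral>x. \<phi> x \<partial>\<nu>) - c \<phi>\<bar> < \<delta>")
      case False
      then show ?thesis using U0 by blast
    next
      case True
      then obtain \<nu>0 where \<nu>0: "\<nu>0 \<in> prob_measures X"
        "\<forall>\<phi>\<in>\<Union>p\<in>D. F p. \<bar>(\<integral>x. \<phi> x \<partial>\<nu>0) - c \<phi>\<bar> < \<delta>" by blast
      obtain p where p: "p \<in> D" "\<forall>\<phi>\<in>F p. \<bar>(\<integral>x. \<phi> x \<partial>\<nu>0) - I \<phi> p\<bar> < \<epsilon> p" using rep[OF \<nu>0(1)] by blast
      show ?thesis
      proof (intro bexI[of _ "U p"] ballI impI)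
        fix \<nu> assume \<nu>: "\<nu> \<in> prob_measures X" "\<forall>\<phi>\<in>\<Union>p\<in>D. F p. \<bar>(\<integral>x. \<phi> x \<partial>\<nu>) - c \<phi>\<bar> < \<delta>"
        have "\<bar>(\<integral>x. \<phi> x \<partial>\<nu>) - I \<phi> p\<bar> < 2 * \<epsilon> p" if "\<phi> \<in> F p" for \<phi>
        proof -
          have "\<phi> \<in> (\<Union>p\<in>D. F p)" using that p(1) by blast
          from bspec[OF \<nu>(2) this] bspec[OF \<nu>0(2) this] bspec[OF p(2) that] \<delta>(2)[OF p(1)]
          show ?thesis by linarith
        qed
        then show "\<nu> \<in> U p" using UF(5)[of p \<nu>] \<nu>(1) p(1) D(1) by blast
      qed (use UF(1) p D in blast)
    qed
  qed (fact \<delta>)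
qed

subsection \<open>Approximation by averages of few points\<close>

lemma ex_le_integral:
  fixes \<phi> :: "'a \<Rightarrow> real"
  assumes "prob_space M" "integrable M \<phi>"
  shows "\<exists>x\<in>space M. \<phi> x \<le> (\<integral>x. \<phi> x \<partial>M)"
proof (rule ccontr)
  interpret prob_space M by fact
  assume "\<not> (\<exists>x\<in>space M. \<phi> x \<le> (\<integral>x. \<phi> x \<partial>M))"
  then have "(\<integral>x. (\<integral>x. \<phi> x \<partial>M) \<partial>M) < (\<integral>x. \<phi> x \<partial>M)"
    using assms(2) emeasure_space_1 by (intro integral_less_AE_space) (auto simp: not_le)
  then show False by (simp add: prob_space)
qed

text \<open>Maurey's argument: having chosen \<open>K\<close> points with error sum \<open>S\<close>, the integral over \<open>x\<close>
  of the inner product of \<open>S\<close> with the error at \<open>x\<close> vanishes, so some \<open>x\<close> makes it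
  nonpositive and the squared norm of the error sum grows by at most that of one error.\<close>
lemma maurey_points:
  fixes \<psi> :: "'i \<Rightarrow> 'a \<Rightarrow> real"
  assumes "prob_space M" "finite J" "\<And>j. j \<in> J \<Longrightarrow> integrable M (\<psi> j)"
    and bound: "\<And>j x. j \<in> J \<Longrightarrow> x \<in> space M \<Longrightarrow> \<bar>\<psi> j x - (\<integral>x. \<psi> j x \<partial>M)\<bar> \<le> b"
  shows "\<exists>y. (\<forall>l<K. y l \<in> space M) \<and>
    (\<Sum>j\<in>J. (\<Sum>l<K. \<psi> j (y l) - (\<integral>x. \<psi> j x \<partial>M))\<^sup>2) \<le> real K * (real (card J) * b\<^sup>2)"
proof (induction K)
  case 0
  then show ?case by simp
next
  case (Suc K)
  then obtain y where y: "\<forall>l<K. y l \<in> space M"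
    "(\<Sum>j\<in>J. (\<Sum>l<K. \<psi> j (y l) - (\<integral>x. \<psi> j x \<partial>M))\<^sup>2) \<le> real K * (real (card J) * b\<^sup>2)" by blast
  interpret prob_space M by fact
  define S where "S j = (\<Sum>l<K. \<psi> j (y l) - (\<integral>x. \<psi> j x \<partial>M))" for j
  define d where "d j x = \<psi> j x - (\<integral>x. \<psi> j x \<partial>M)" for j x
  have int: "integrable M (\<lambda>x. S j * d j x)" if "j \<in> J" for j
    unfolding d_def using assms(3)[OF that] by simp
  have "(\<integral>x. (\<Sum>j\<in>J. S j * d j x) \<partial>M) = (\<Sum>j\<in>J. S j * (\<integral>x. d j x \<partial>M))"
    using int by (subst Bochner_Integration.integral_sum) auto
  also have "\<dots> = 0"
    using assms(3) by (intro sum.neutral) (auto simp: d_def prob_space)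
  finally have "(\<integral>x. (\<Sum>j\<in>J. S j * d j x) \<partial>M) = 0" .
  moreover obtain z where z: "z \<in> space M" "(\<Sum>j\<in>J. S j * d j z) \<le> (\<integral>x. (\<Sum>j\<in>J. S j * d j x) \<partial>M)"
    using ex_le_integral[OF assms(1), of "\<lambda>x. \<Sum>j\<in>J. S j * d j x"] int by auto
  ultimately have cross: "(\<Sum>j\<in>J. S j * d j z) \<le> 0" by simp
  have "(d j z)\<^sup>2 \<le> b\<^sup>2" if "j \<in> J" for j
    using bound[OF that z(1)] unfolding d_def by (metis abs_ge_zero power2_abs power_mono)
  then have sq: "(\<Sum>j\<in>J. (d j z)\<^sup>2) \<le> real (card J) * b\<^sup>2" using sum_bounded_above[of J "\<lambda>j. (d j z)\<^sup>2" "b\<^sup>2"] by simp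
  have "(\<Sum>j\<in>J. (\<Sum>l<Suc K. \<psi> j ((y(K := z)) l) - (\<integral>x. \<psi> j x \<partial>M))\<^sup>2) = (\<Sum>j\<in>J. (S j + d j z)\<^sup>2)"
    by (intro sum.cong) (auto simp: S_def d_def)
  also have "\<dots> = (\<Sum>j\<in>J. (S j)\<^sup>2) + 2 * (\<Sum>j\<in>J. S j * d j z) + (\<Sum>j\<in>J. (d j z)\<^sup>2)"
    by (simp add: power2_sum sum.distrib sum_distrib_left algebra_simps)
  also have "\<dots> \<le> real K * (real (card J) * b\<^sup>2) + real (card J) * b\<^sup>2"
    using y(2) cross sq unfolding S_def by linarith
  finally show ?case
    using y(1) z(1) by (intro exI[of _ "y(K := z)"]) (auto simp: less_Suc_eq algebra_simps)
qed

text \<open>Markov's inequality for counting measure.\<close>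

lemma card_large_le:
  fixes S :: "'i \<Rightarrow> real"
  assumes "finite I" "r > 0" "(\<Sum>i\<in>I. S i) \<le> C" "\<And>i. i \<in> I \<Longrightarrow> 0 \<le> S i"
  shows "real (card {i \<in> I. S i \<ge> r}) \<le> C / r"
proof -
  have "real (card {i \<in> I. S i \<ge> r}) * r = (\<Sum>i\<in>{i \<in> I. S i \<ge> r}. r)" by simp
  also have "\<dots> \<le> (\<Sum>i\<in>{i \<in> I. S i \<ge> r}. S i)" by (intro sum_mono) auto
  also have "\<dots> \<le> (\<Sum>i\<in>I. S i)" using assms by (intro sum_mono2) auto
  finally show ?thesis using assms by (simp add: field_simps)
qed

text \<open>The Chernoff-type weight \<open>x\<close> per deviation turns the count into a product over coordinates.\<close>
lemma card_hamming_ball_le: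
  fixes x \<eta> :: real
  assumes "finite \<U>" "0 < x" "x \<le> 1"
  shows "real (card {u \<in> {..<n} \<rightarrow>\<^sub>E \<U>. real (card {i \<in> {..<n}. u i \<noteq> b i}) \<le> \<eta> * real n})
     \<le> (x powr - \<eta> * (1 + real (card \<U>) * x)) ^ n"
proof -
  let ?H = "{u \<in> {..<n} \<rightarrow>\<^sub>E \<U>. real (card {i \<in> {..<n}. u i \<noteq> b i}) \<le> \<eta> * real n}"
  have fin: "finite ({..<n} \<rightarrow>\<^sub>E \<U>)" using assms by (intro finite_PiE) auto
  have "real (card ?H) * x powr (\<eta> * real n) = (\<Sum>u\<in>?H. x powr (\<eta> * real n))" by simp
  also have "\<dots> \<le> (\<Sum>u\<in>?H. \<Prod>i<n. if u i = b i then 1 else x)"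
  proof (rule sum_mono)
    fix u assume u: "u \<in> ?H"
    have "x powr (\<eta> * real n) \<le> x powr real (card {i \<in> {..<n}. u i \<noteq> b i})"
      by (rule powr_mono') (use u assms in auto)
    also have "\<dots> = (\<Prod>i\<in>{i \<in> {..<n}. u i \<noteq> b i}. x)"
      using assms by (simp add: powr_realpow)
    also have "\<dots> = (\<Prod>i<n. if u i = b i then 1 else x)"
      by (subst prod.inter_filter) (auto intro: prod.cong)
    finally show "x powr (\<eta> * real n) \<le> (\<Prod>i<n. if u i = b i then 1 else x)" .
  qed
  also have "\<dots> \<le> (\<Sum>u\<in>{..<n} \<rightarrow>\<^sub>E \<U>. \<Prod>i<n. if u i = b i then 1 else x)"
    using fin assms by (intro sum_mono2 prod_nonneg) auto
  also have "\<dots> = (\<Prod>i<n. \<Sum>v\<in>\<U>. if v = b i then 1 else x)"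
    using assms(1) by (subst prod_sum_PiE) auto
  also have "\<dots> \<le> (\<Prod>i<n. 1 + real (card \<U>) * x)"
  proof (rule prod_mono)
    fix i
    \<comment> \<open>At most one \<open>v\<close> equals \<open>b i\<close>, and \<open>b i\<close>
      need not lie in \<open>\<U>\<close>; hence an inequality.\<close>
    have "(\<Sum>v\<in>\<U>. if v = b i then 1 else x) \<le> (\<Sum>v\<in>\<U>. (if v = b i then 1 else 0) + x)"
      using assms by (intro sum_mono) auto
    also have "\<dots> \<le> 1 + real (card \<U>) * x"
      using assms by (simp add: sum.distrib)
    finally show "0 \<le> (\<Sum>v\<in>\<U>. if v = b i then 1 else x) \<and> (\<Sum>v\<in>\<U>. if v = b i then 1 else x) \<le> 1 + real (card \<U>) * x"
      using assms by (auto intro!: sum_nonneg)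
  qed
  finally have "real (card ?H) * x powr (\<eta> * real n) \<le> (1 + real (card \<U>) * x) ^ n" by simp
  then have "real (card ?H) \<le> x powr (- \<eta> * real n) * (1 + real (card \<U>) * x) ^ n"
    using assms by (simp add: powr_minus field_simps)
  also have "x powr (- \<eta> * real n) = (x powr - \<eta>) ^ n"
    using assms powr_powr[of x "- \<eta>" "real n"] powr_realpow[of "x powr - \<eta>" n] by simp
  finally show ?thesis by (simp add: power_mult_distrib)
qed

text \<open>Each measure receives an itinerary through \<open>\<U>\<close> that differs at no more
  than \<open>\<eta> n\<close> times from a base itinerary fixed by a \<open>K\<close>-tuple from a
  minimal subcover. The first factor counts tuples, the second bounds the Hamming ball. The
  tolerance \<open>\<epsilon>\<close> is split evenly between oscillation and Maurey error.\<close>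

lemma min_subcover_push_le:
  fixes X :: "'a::metric_space set" and F :: "('a \<Rightarrow> real) set"
  assumes X: "compact X" and f: "\<And>n. continuous_on X (f n)" "\<And>n. f n ` X \<subseteq> X"
    and \<U>: "\<U> \<in> open_covers (weak_star_topology X)"
    and F: "finite F" "\<And>\<phi>. \<phi> \<in> F \<Longrightarrow> continuous_on X \<phi>" "\<And>\<phi> x. \<phi> \<in> F \<Longrightarrow> x \<in> X \<Longrightarrow> \<bar>\<phi> x\<bar> \<le> b"
    and \<epsilon>: "\<epsilon> > 0"
    and leb: "\<And>c. \<exists>U\<in>\<U>. \<forall>\<nu>\<in>prob_measures X. (\<forall>\<phi>\<in>F. \<bar>(\<integral>x. \<phi> x \<partial>\<nu>) - c \<phi>\<bar> < \<epsilon>) \<longrightarrow> \<nu> \<in> U"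
    and \<A>: "\<A> \<in> open_covers (top_of_set X)"
    and osc: "\<And>A \<phi> x y. A \<in> \<A> \<Longrightarrow> \<phi> \<in> F \<Longrightarrow> x \<in> A \<Longrightarrow> y \<in> A \<Longrightarrow> \<bar>\<phi> x - \<phi> y\<bar> \<le> \<epsilon> / 2"
    and K: "K > 0" "real (card F) * (2 * b)\<^sup>2 / (\<epsilon> / 2)\<^sup>2 \<le> \<eta> * real K"
    and x: "0 < x" "x \<le> 1"
  shows "real (min_subcover (weak_star_topology X) (join_cover (weak_star_topology X) (push_seq X f) a \<U> n))
    \<le> real (min_subcover (top_of_set X) (join_cover (top_of_set X) f a \<A> n)) ^ K *
       (x powr - \<eta> * (1 + real (card \<U>) * x)) ^ n"
proof -
  define g where "g i = comp_seq f (a i)" for i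
  define G where "G i = comp_seq (push_seq X f) (a i)" for i
  have g: "continuous_on X (g i)" "g i ` X \<subseteq> X" for i
    using comp_seq_continuous_self_map[OF f] by (auto simp: g_def)
  have G: "G i \<mu> \<in> prob_measures X" if "\<mu> \<in> prob_measures X" for i \<mu>
    unfolding G_def by (intro comp_seq_in push_seq_in_prob_measures f that)
  have fin\<U>: "finite \<U>" using \<U> by (auto simp: open_covers_def)
  have "finite (join_cover (top_of_set X) f a \<A> n)"
    using \<A> by (auto simp: open_covers_def intro: finite_join_cover)
  moreover have "topspace (top_of_set X) \<subseteq> \<Union>(join_cover (top_of_set X) f a \<A> n)"
    using f(2) by (intro join_cover_covers[OF \<A>]) auto
  ultimately obtain \<V> where \<V>: "\<V> \<subseteq> join_cover (top_of_set X) f a \<A> n" "finite \<V>" "X \<subseteq> \<Union>\<V>"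
    "card \<V> = min_subcover (top_of_set X) (join_cover (top_of_set X) f a \<A> n)"
    using min_subcover_attained[of "join_cover (top_of_set X) f a \<A> n" "top_of_set X"] by auto
  have osc_join: "\<bar>\<phi> (g i z) - \<phi> (g i z')\<bar> \<le> \<epsilon> / 2"
    if V: "V \<in> \<V>" and z: "z \<in> V" "z' \<in> V" "i < n" and \<phi>: "\<phi> \<in> F" for V z z' i \<phi>
  proof -
    obtain A where A: "V = topspace (top_of_set X) \<inter> (\<Inter>i\<in>{..<n}. comp_seq f (a i) -` A i)"
      "\<forall>i<n. A i \<in> \<A>"
      using V \<V>(1) unfolding join_cover_def by blast
    show ?thesis
      using z by (intro osc[of "A i"] \<phi>) (auto simp: A g_def)
  qed
  \<comment> \<open>Maurey's points depend on the measure; replacing each by the representative of a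
    set containing it leaves only \<open>card \<V> ^ K\<close> tuples.\<close>
  define r where "r V = (SOME z. z \<in> V)" for V :: "'a set"
  have r: "r V \<in> V" if "z \<in> V" for V z
    unfolding r_def using that by (rule someI)
  obtain L where L: "\<And>c. L c \<in> \<U>"
    "\<And>c \<nu>. \<nu> \<in> prob_measures X \<Longrightarrow> (\<forall>\<phi>\<in>F. \<bar>(\<integral>x. \<phi> x \<partial>\<nu>) - c \<phi>\<bar> < \<epsilon>) \<Longrightarrow> \<nu> \<in> L c"
    using bchoice[of UNIV "\<lambda>c U. U \<in> \<U> \<and> (\<forall>\<nu>\<in>prob_measures X. (\<forall>\<phi>\<in>F. \<bar>(\<integral>x. \<phi> x \<partial>\<nu>) - c \<phi>\<bar> < \<epsilon>) \<longrightarrow> \<nu> \<in> U)"] leb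
    by blast
  define base where "base y i = L (\<lambda>\<phi>. (\<Sum>l<K. \<phi> (g i (r (y l)))) / real K)" for y :: "nat \<Rightarrow> 'a set" and i
  define H where "H y = {u \<in> {..<n} \<rightarrow>\<^sub>E \<U>. real (card {i \<in> {..<n}. u i \<noteq> base y i}) \<le> \<eta> * real n}" for y
  define Z where "Z = (\<Union>y\<in>{..<K} \<rightarrow>\<^sub>E \<V>. H y)"
  define J where "J u = topspace (weak_star_topology X) \<inter> (\<Inter>i\<in>{..<n}. comp_seq (push_seq X f) (a i) -` u i)" for u
  have finY: "finite ({..<K} \<rightarrow>\<^sub>E \<V>)" using \<V>(2) by (intro finite_PiE) auto
  have Zsub: "Z \<subseteq> {..<n} \<rightarrow>\<^sub>E \<U>" unfolding Z_def H_def by auto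
  then have finZ: "finite Z" by (rule finite_subset) (use fin\<U> in \<open>auto intro: finite_PiE\<close>)
  have cover: "\<exists>u\<in>Z. \<mu> \<in> J u" if \<mu>: "\<mu> \<in> prob_measures X" for \<mu>
  proof -
    interpret prob_space \<mu> using prob_measuresD(1)[OF \<mu>] .
    have sp: "space \<mu> = X" using prob_measuresD(3)[OF \<mu>] .
    define \<psi> where "\<psi> j z = (case j of (i, \<phi>) \<Rightarrow> \<phi> (g i z))" for j :: "nat \<times> ('a \<Rightarrow> real)" and z
    define m where "m j = (\<integral>z. \<psi> j z \<partial>\<mu>)" for j
    have cont: "continuous_on X (\<psi> (i, \<phi>))" if "\<phi> \<in> F" for i \<phi>
      unfolding \<psi>_def using continuous_on_compose[OF g(1) continuous_on_subset[OF F(2)[OF that] g(2)]]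
      by (simp add: o_def)
    have int: "integrable \<mu> (\<psi> j)" if "j \<in> {..<n} \<times> F" for j
      using integrable_prob_measures[OF X \<mu> cont] that by (cases j) auto
    have bnd: "\<bar>\<psi> j z\<bar> \<le> b" if "j \<in> {..<n} \<times> F" "z \<in> X" for j z
      using that g(2) by (cases j) (auto simp: \<psi>_def image_subset_iff intro!: F(3))
    have bndm: "\<bar>\<psi> j z - (\<integral>z. \<psi> j z \<partial>\<mu>)\<bar> \<le> 2 * b" if "j \<in> {..<n} \<times> F" "z \<in> space \<mu>" for j z
    proof -
      have "\<bar>\<integral>z. \<psi> j z \<partial>\<mu>\<bar> \<le> (\<integral>z. \<bar>\<psi> j z\<bar> \<partial>\<mu>)" by (rule integral_abs_bound)
      also have "\<dots> \<le> (\<integral>z. b \<partial>\<mu>)" using int[OF that(1)] bnd[OF that(1)] sp by (intro integral_mono) auto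
      also have "\<dots> = b" by (simp add: prob_space)
      finally show ?thesis using bnd[OF that(1), of z] that(2) sp by simp
    qed
    have "\<exists>y. (\<forall>l<K. y l \<in> space \<mu>) \<and>
      (\<Sum>j\<in>{..<n} \<times> F. (\<Sum>l<K. \<psi> j (y l) - m j)\<^sup>2) \<le> real K * (real (card ({..<n} \<times> F)) * (2 * b)\<^sup>2)"
      unfolding m_def by (rule maurey_points[OF prob_space_axioms finite_cartesian_product[OF finite_lessThan F(1)]])
        (fact int bndm)+
    then obtain y where y: "\<forall>l<K. y l \<in> space \<mu>"
      "(\<Sum>j\<in>{..<n} \<times> F. (\<Sum>l<K. \<psi> j (y l) - m j)\<^sup>2) \<le> real K * (real (card ({..<n} \<times> F)) * (2 * b)\<^sup>2)"
      by (elim exE conjE)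
    have "\<forall>l\<in>{..<K}. \<exists>V. V \<in> \<V> \<and> y l \<in> V" using y(1) sp \<V>(3) by blast
    then obtain V' where V': "\<And>l. l < K \<Longrightarrow> V' l \<in> \<V> \<and> y l \<in> V' l" by (metis lessThan_iff)
    define V where "V = restrict V' {..<K}"
    have V: "V \<in> {..<K} \<rightarrow>\<^sub>E \<V>" "\<And>l. l < K \<Longrightarrow> V l \<in> \<V>" "\<And>l. l < K \<Longrightarrow> y l \<in> V l"
      using V' by (auto simp: V_def)
    \<comment> \<open>\<open>S i\<close> is the total squared error at time \<open>i\<close>. Below
      the threshold \<open>\<rho>\<close>, each test function has average error under
      \<open>\<epsilon> / 2\<close>; Markov's inequality and the choice of \<open>K\<close> leave at
      most \<open>\<eta> n\<close> other times.\<close>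
    define S where "S i = (\<Sum>\<phi>\<in>F. (\<Sum>l<K. \<psi> (i, \<phi>) (y l) - m (i, \<phi>))\<^sup>2)" for i
    define \<rho> where "\<rho> = (real K * (\<epsilon> / 2))\<^sup>2"
    have \<rho>: "\<rho> > 0" using K(1) \<epsilon> by (simp add: \<rho>_def)
    have "(\<Sum>i<n. S i) \<le> real K * (real n * real (card F) * (2 * b)\<^sup>2)"
      using y(2) by (simp add: S_def sum.cartesian_product card_cartesian_product)
    then have "real (card {i \<in> {..<n}. S i \<ge> \<rho>}) \<le> real K * (real n * real (card F) * (2 * b)\<^sup>2) / \<rho>"
      using \<rho> by (intro card_large_le) (auto simp: S_def intro!: sum_nonneg)
    also have "\<dots> = real n * (real (card F) * (2 * b)\<^sup>2 / (\<epsilon> / 2)\<^sup>2 / real K)"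
      using K(1) \<epsilon> by (simp add: \<rho>_def field_simps power2_eq_square)
    also have "\<dots> \<le> real n * \<eta>"
      using iffD2[OF pos_divide_le_eq[of "real K"], OF _ K(2)] K(1) by (intro mult_left_mono) simp_all
    finally have bad: "real (card {i \<in> {..<n}. S i \<ge> \<rho>}) \<le> \<eta> * real n" by (simp add: mult.commute)
    have good: "G i \<mu> \<in> base V i" if "i < n" "S i < \<rho>" for i
      unfolding base_def
    proof (intro L(2) G \<mu> ballI)
      fix \<phi> assume \<phi>: "\<phi> \<in> F"
      have "(\<Sum>l<K. \<psi> (i, \<phi>) (y l) - m (i, \<phi>))\<^sup>2 \<le> S i"
        unfolding S_def using F(1) \<phi> by (intro member_le_sum) auto
      then have "(\<Sum>l<K. \<psi> (i, \<phi>) (y l) - m (i, \<phi>))\<^sup>2 < (real K * (\<epsilon> / 2))\<^sup>2"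
        using that(2) unfolding \<rho>_def by simp
      then have "\<bar>\<Sum>l<K. \<psi> (i, \<phi>) (y l) - m (i, \<phi>)\<bar> < real K * (\<epsilon> / 2)"
        using \<epsilon> power2_less_imp_less[of "\<bar>\<Sum>l<K. \<psi> (i, \<phi>) (y l) - m (i, \<phi>)\<bar>" "real K * (\<epsilon> / 2)"]
        unfolding power2_abs by simp
      moreover have "\<bar>\<Sum>l<K. \<phi> (g i (r (V l))) - \<phi> (g i (y l))\<bar> \<le> real K * (\<epsilon> / 2)"
      proof -
        have "\<bar>\<Sum>l<K. \<phi> (g i (r (V l))) - \<phi> (g i (y l))\<bar> \<le> (\<Sum>l<K. \<bar>\<phi> (g i (r (V l))) - \<phi> (g i (y l))\<bar>)"
          by (rule sum_abs)
        also have "\<dots> \<le> (\<Sum>l<K. \<epsilon> / 2)"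
          using V(2,3) r[OF V(3)] that \<phi> by (intro sum_mono osc_join) auto
        finally show ?thesis by simp
      qed
      moreover have "(\<Sum>l<K. \<phi> (g i (r (V l)))) - real K * m (i, \<phi>) =
          (\<Sum>l<K. \<phi> (g i (r (V l))) - \<phi> (g i (y l))) + (\<Sum>l<K. \<psi> (i, \<phi>) (y l) - m (i, \<phi>))"
        by (simp add: sum_subtractf \<psi>_def)
      ultimately have "\<bar>(\<Sum>l<K. \<phi> (g i (r (V l)))) - real K * m (i, \<phi>)\<bar> < real K * \<epsilon>"
        by (simp add: field_simps)
      moreover have "(\<Sum>l<K. \<phi> (g i (r (V l)))) - real K * m (i, \<phi>) =
          real K * ((\<Sum>l<K. \<phi> (g i (r (V l)))) / real K - m (i, \<phi>))"
        using K(1) by (simp add: right_diff_distrib)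
      ultimately have "\<bar>(\<Sum>l<K. \<phi> (g i (r (V l)))) / real K - m (i, \<phi>)\<bar> < \<epsilon>"
        using K(1) by (simp add: abs_mult)
      moreover have "(\<integral>z. \<phi> z \<partial>G i \<mu>) = m (i, \<phi>)"
        unfolding G_def m_def \<psi>_def g_def
        using integral_comp_seq_push_seq[of X f \<mu> \<phi> "a i"] f \<mu> F(2)[OF \<phi>] by simp
      ultimately show "\<bar>(\<integral>z. \<phi> z \<partial>G i \<mu>) - (\<Sum>l<K. \<phi> (g i (r (V l)))) / real K\<bar> < \<epsilon>"
        by (simp add: abs_minus_commute)
    qed
    \<comment> \<open>At the exceptional times, any member of the cover containing the image measure
      is used.\<close>
    have "\<exists>U\<in>\<U>. G i \<mu> \<in> U" for i
      using G[OF \<mu>, of i] \<U> unfolding open_covers_def by auto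
    then obtain W where W: "\<And>i. W i \<in> \<U>" "\<And>i. G i \<mu> \<in> W i" by metis
    define u where "u = (\<lambda>i\<in>{..<n}. if S i < \<rho> then base V i else W i)"
    have "u \<in> {..<n} \<rightarrow>\<^sub>E \<U>" using L(1) W(1) by (auto simp: u_def base_def)
    moreover have "card {i \<in> {..<n}. u i \<noteq> base V i} \<le> card {i \<in> {..<n}. S i \<ge> \<rho>}"
      by (intro card_mono) (auto simp: u_def)
    then have "real (card {i \<in> {..<n}. u i \<noteq> base V i}) \<le> \<eta> * real n"
      using bad by linarith
    ultimately have "u \<in> H V" unfolding H_def by simp
    then have "u \<in> Z" using V(1) unfolding Z_def by blast
    moreover have "\<mu> \<in> J u"
      using \<mu> good W(2) by (auto simp: J_def u_def G_def)
    ultimately show ?thesis by blast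
  qed
  have "J ` Z \<subseteq> join_cover (weak_star_topology X) (push_seq X f) a \<U> n"
    unfolding join_cover_eq_image J_def using Zsub by blast
  then have "min_subcover (weak_star_topology X) (join_cover (weak_star_topology X) (push_seq X f) a \<U> n)
      \<le> card (J ` Z)"
    using finZ cover by (intro min_subcover_le) auto
  also have "\<dots> \<le> card Z" using finZ by (rule card_image_le)
  also have "\<dots> \<le> (\<Sum>y\<in>{..<K} \<rightarrow>\<^sub>E \<V>. card (H y))"
    unfolding Z_def using finY by (rule card_UN_le)
  finally have "real (min_subcover (weak_star_topology X) (join_cover (weak_star_topology X) (push_seq X f) a \<U> n))
      \<le> (\<Sum>y\<in>{..<K} \<rightarrow>\<^sub>E \<V>. real (card (H y)))" by (metis of_nat_le_iff of_nat_sum)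
  also have "\<dots> \<le> (\<Sum>y\<in>{..<K} \<rightarrow>\<^sub>E \<V>. (x powr - \<eta> * (1 + real (card \<U>) * x)) ^ n)"
    unfolding H_def using card_hamming_ball_le[OF fin\<U> x] by (intro sum_mono) auto
  also have "\<dots> = real (card \<V>) ^ K * (x powr - \<eta> * (1 + real (card \<U>) * x)) ^ n"
    by (simp add: card_funcsetE)
  finally show ?thesis using \<V>(4) by simp
qed

section \<open>From points to measures: choice of the constants\<close>

lemma ex_small_oscillation_cover:
  fixes X :: "'a::metric_space set" and F :: "('a \<Rightarrow> real) set"
  assumes X: "compact X" and F: "finite F" "\<And>\<phi>. \<phi> \<in> F \<Longrightarrow> continuous_on X \<phi>" and "\<epsilon> > 0"
  obtains \<A> where "\<A> \<in> open_covers (top_of_set X)"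
    "\<And>A \<phi> x y. A \<in> \<A> \<Longrightarrow> \<phi> \<in> F \<Longrightarrow> x \<in> A \<Longrightarrow> y \<in> A \<Longrightarrow> \<bar>\<phi> x - \<phi> y\<bar> \<le> \<epsilon>"
proof -
  define Nb where "Nb z = X \<inter> (\<Inter>\<phi>\<in>F. {x \<in> X. \<phi> x \<in> ball (\<phi> z) (\<epsilon> / 2)})" for z
  have op: "openin (top_of_set X) (Nb z)" for z
  proof -
    have "openin (top_of_set X) {x \<in> X. \<phi> x \<in> ball (\<phi> z) (\<epsilon> / 2)}" if "\<phi> \<in> F" for \<phi>
      using continuous_openin_preimage_gen[OF F(2)[OF that], of "ball (\<phi> z) (\<epsilon> / 2)"]
      by (simp add: vimage_def Int_def)
    then show ?thesis
      unfolding Nb_def using F(1) by (cases "F = {}") (auto intro!: openin_Int openin_INT)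
  qed
  then have "\<forall>c\<in>Nb ` X. openin (top_of_set X) c" by blast
  moreover have "X \<subseteq> \<Union>(Nb ` X)" using \<open>\<epsilon> > 0\<close> by (auto simp: Nb_def)
  ultimately obtain \<D> where \<D>: "\<D> \<subseteq> Nb ` X" "finite \<D>" "X \<subseteq> \<Union>\<D>"
    using X[unfolded compact_eq_openin_cover, rule_format, of "Nb ` X"] by blast
  show ?thesis
  proof (rule that[of \<D>])
    show "\<D> \<in> open_covers (top_of_set X)"
      using \<D> op unfolding open_covers_def by (auto simp: Nb_def)
    show "\<bar>\<phi> x - \<phi> y\<bar> \<le> \<epsilon>" if A: "A \<in> \<D>" and xy: "\<phi> \<in> F" "x \<in> A" "y \<in> A" for A \<phi> x y
    proof -
      obtain z where "A = Nb z" using A \<D> by blast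
      then have "\<phi> x \<in> ball (\<phi> z) (\<epsilon> / 2)" "\<phi> y \<in> ball (\<phi> z) (\<epsilon> / 2)"
        using xy unfolding Nb_def by blast+
      then show ?thesis unfolding mem_ball dist_real_def by linarith
    qed
  qed
qed

lemma seq_entropy_push_zero:
  fixes X :: "'a::metric_space set"
  assumes X: "compact X" "X \<noteq> {}" and f: "\<And>n. continuous_on X (f n)" "\<And>n. f n ` X \<subseteq> X"
    and zero: "seq_entropy (top_of_set X) f a = 0"
  shows "seq_entropy (weak_star_topology X) (push_seq X f) a = 0"
  unfolding seq_entropy_eq_0_iff
proof (intro ballI allI impI)
  fix \<U> and \<gamma> :: real assume \<U>: "\<U> \<in> open_covers (weak_star_topology X)" and \<gamma>: "\<gamma> > 0"
  obtain F :: "('a \<Rightarrow> real) set" and \<epsilon> :: real where F: "finite F" "\<And>\<phi>. \<phi> \<in> F \<Longrightarrow> continuous_on X \<phi>"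
    and \<epsilon>: "\<epsilon> > 0"
    and leb: "\<And>c. \<exists>U\<in>\<U>. \<forall>\<nu>\<in>prob_measures X. (\<forall>\<phi>\<in>F. \<bar>(\<integral>x. \<phi> x \<partial>\<nu>) - c \<phi>\<bar> < \<epsilon>) \<longrightarrow> \<nu> \<in> U"
    using weak_star_lebesgue_number[OF X \<U>] by blast
  obtain b where b: "\<And>\<phi> x. \<phi> \<in> F \<Longrightarrow> x \<in> X \<Longrightarrow> \<bar>\<phi> x\<bar> \<le> b"
  proof -
    have "bounded (\<Union>\<phi>\<in>F. \<phi> ` X)"
      using F X by (auto intro!: bounded_UN compact_imp_bounded compact_continuous_image)
    then show ?thesis using that unfolding bounded_real by blast
  qed
  define R where "R = real (card \<U>)"
  \<comment> \<open>The order of choices matters: first \<open>x\<close>, giving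
    \<open>R * x \<le> \<gamma> / 4\<close>; then \<open>\<eta>\<close>, giving
    \<open>- \<eta> * ln x \<le> \<gamma> / 4\<close>; then \<open>K\<close>; and only then large
    \<open>n\<close>, with \<open>K\<close> times the growth rate of \<open>N\<close> below
    \<open>\<gamma> / 4\<close>. The total is below \<open>\<gamma>\<close>.\<close>
  define x where "x = min 1 (\<gamma> / (4 * (R + 1)))"
  have R: "R \<ge> 0" by (simp add: R_def)
  have x: "0 < x" "x \<le> 1" using \<gamma> R by (auto simp: x_def)
  have "R * x \<le> (R + 1) * (\<gamma> / (4 * (R + 1)))"
    using R x by (intro mult_mono) (auto simp: x_def)
  also have "\<dots> = \<gamma> / 4" using R by (simp add: field_simps)
  finally have Rx: "R * x \<le> \<gamma> / 4" .
  \<comment> \<open>The 1 in the denominator keeps it positive when \<open>x = 1\<close>.\<close>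
  define \<eta> where "\<eta> = \<gamma> / (4 * (1 - ln x))"
  have lnx: "ln x \<le> 0" using x by simp
  have \<eta>: "\<eta> > 0" using \<gamma> lnx by (simp add: \<eta>_def)
  have "- \<eta> * ln x \<le> \<eta> * (1 - ln x)" using \<eta> by (simp add: algebra_simps)
  also have "\<dots> = \<gamma> / 4" using lnx by (simp add: \<eta>_def field_simps)
  finally have \<eta>x: "- \<eta> * ln x \<le> \<gamma> / 4" .
  define C where "C = real (card F) * (2 * b)\<^sup>2 / (\<epsilon> / 2)\<^sup>2"
  have "C \<ge> 0" by (simp add: C_def)
  obtain K where "C / \<eta> < real K" using reals_Archimedean2 by blast
  moreover have "0 \<le> C / \<eta>" using \<eta> \<open>C \<ge> 0\<close> by simp
  ultimately have "0 < real K" "C < \<eta> * real K"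
    using \<eta> by (linarith, simp add: pos_divide_less_eq mult.commute)
  then have K: "K > 0" "C \<le> \<eta> * real K" by simp_all
  obtain \<A> where \<A>: "\<A> \<in> open_covers (top_of_set X)"
    "\<And>A \<phi> x y. A \<in> \<A> \<Longrightarrow> \<phi> \<in> F \<Longrightarrow> x \<in> A \<Longrightarrow> y \<in> A \<Longrightarrow> \<bar>\<phi> x - \<phi> y\<bar> \<le> \<epsilon> / 2"
    using ex_small_oscillation_cover[OF X(1) F, of "\<epsilon> / 2"] \<epsilon> by (metis half_gt_zero)
  define M where "M n = real (min_subcover (weak_star_topology X)
     (join_cover (weak_star_topology X) (push_seq X f) a \<U> n))" for n
  define N where "N n = real (min_subcover (top_of_set X) (join_cover (top_of_set X) f a \<A> n))" for n
  have MN: "M n \<le> N n ^ K * (x powr - \<eta> * (1 + R * x)) ^ n" for n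
    unfolding M_def N_def R_def
    by (rule min_subcover_push_le[where F=F and b=b and \<epsilon>=\<epsilon>])
      (fact X(1) f \<U> F b \<epsilon> leb \<A> K[unfolded C_def] x)+
  have "\<forall>\<^sub>F n in sequentially. ln (N n) / real n < \<gamma> / (4 * real K)"
    using zero \<A>(1) \<gamma> K(1) unfolding seq_entropy_eq_0_iff N_def by simp
  then show "\<forall>\<^sub>F n in sequentially. ln (real (min_subcover (weak_star_topology X)
     (join_cover (weak_star_topology X) (push_seq X f) a \<U> n))) / real n < \<gamma>"
    using eventually_gt_at_top[of 0]
  proof eventually_elim
    case (elim n)
    have "ln (M n) / real n < \<gamma>"
    \<comment> \<open>For \<open>M n = 0\<close> the quotient is 0 since \<open>ln 0 = 0\<close>.
      Otherwise \<open>K > 0\<close> and \<open>MN\<close> force \<open>N n\<close> to be positive,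
      so the product can be split by logarithms.\<close>
    proof (cases "M n = 0")
      case False
      then have M: "M n > 0" by (simp add: M_def)
      then have "N n \<noteq> 0" using MN[of n] K(1) by (auto simp: zero_power)
      then have N: "N n > 0" by (simp add: N_def)
      have pos: "x powr - \<eta> > 0" "1 + R * x > 0" using x R by (auto intro: add_pos_nonneg)
      have "ln (M n) \<le> ln (N n ^ K * (x powr - \<eta> * (1 + R * x)) ^ n)"
        using M MN[of n] by simp
      also have "\<dots> = real K * ln (N n) + real n * (- \<eta> * ln x + ln (1 + R * x))"
        using N pos x by (simp add: ln_mult ln_realpow ln_powr)
      also have "\<dots> \<le> real K * ln (N n) + real n * (\<gamma> / 4 + \<gamma> / 4)"
      proof -
        have "ln (1 + R * x) \<le> R * x" using R x by (intro ln_add_one_self_le_self) auto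
        then show ?thesis using \<eta>x Rx by (intro add_left_mono mult_left_mono) auto
      qed
      finally have "ln (M n) / real n \<le> real K * (ln (N n) / real n) + \<gamma> / 2"
        using elim(2) by (simp add: field_simps)
      also have "real K * (ln (N n) / real n) < real K * (\<gamma> / (4 * real K))"
        using elim(1) K(1) by (intro mult_strict_left_mono) auto
      finally have "ln (M n) / real n < \<gamma> / 4 + \<gamma> / 2" using K(1) by simp
      then show ?thesis using \<gamma> by linarith
    qed (use \<gamma> in simp)
    then show ?case by (simp add: M_def)
  qed
qed

section \<open>The equivalence, with the empty space treated separately\<close>

lemma prob_measures_empty: "prob_measures {} = {}"
  using prob_space.not_empty prob_measuresD by fastforce

lemma seq_entropy_zero_iff_push:
  fixes X :: "'a::metric_space set"
  assumes "compact X" "\<And>n. continuous_on X (f n)" "\<And>n. f n ` X \<subseteq> X"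
  shows "seq_entropy (top_of_set X) f a = 0 \<longleftrightarrow>
    seq_entropy (weak_star_topology X) (push_seq X f) a = 0"
proof (cases "X = {}")
  case True
  then show ?thesis
    using seq_entropy_empty[of "top_of_set X"] seq_entropy_empty[of "weak_star_topology X"]
    by (simp add: prob_measures_empty)
next
  case False
  then show ?thesis using seq_entropy_push_zero seq_entropy_zero_of_push assms by metis
qed

theorem theorem5p3:
  fixes X :: "'a::metric_space set" and f :: "nat \<Rightarrow> 'a \<Rightarrow> 'a" and a :: "nat \<Rightarrow> nat"
  assumes "compact X"
    and "\<And>n. continuous_on X (f n)"
    and "\<And>n. f n ` X \<subseteq> X"
    and "strict_mono a"
  shows "(seq_entropy (top_of_set X) f a = 0 \<longleftrightarrow>
            seq_entropy (weak_star_topology X) (push_seq X f) a = 0)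
       \<and> (null_system (top_of_set X) f \<longleftrightarrow>
            null_system (weak_star_topology X) (push_seq X f))"
  using seq_entropy_zero_iff_push[of X f, OF assms(1-3)] unfolding null_system_def by blast

end
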